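(* Let $\overline{M}=(M_1\times_f M_2)\times_h M_3$ be a quasi-Einstein sequential warped product manifold whose Ricci tensor is of the form $\overline{Ric}=\alpha\overline{g}+\beta A\otimes A$, where $A(X)=\overline{g}(X,U)$ and $U$ is a vector field on $\overline{M}$ with components $U=U_1+U_2+U_3$ tangent to $M_1,M_2,M_3$. Then the Ricci tensors of $M_1$, $M_2$ and $M_3$ satisfy, for all $X_i,Y_i\in\chi(M_i)$, $$Ric^1(X_1,Y_1)=\alpha g_1(X_1,Y_1)+\beta g_1(X_1,U_1)g_1(Y_1,U_1)+\frac{m_2}{f}H_1^f(X_1,Y_1)+\frac{m_3}{h}H^h(X_1,Y_1),$$ $$Ric^2(X_2,Y_2)=\left(\alpha f^2+f\Delta^1f+(m_2-1)\|grad^1f\|^2\right)g_2(X_2,Y_2)+\beta f^4g_2(X_2,U_2)g_2(Y_2,U_2)+\frac{m_3}{h}H^h(X_2,Y_2),$$ $$Ric^3(X_3,Y_3)=\left(\alpha h^2+h\Delta h+(m_3-1)\|grad\,h\|^2\right)g_3(X_3,Y_3)+\beta h^4g_3(X_3,U_3)g_3(Y_3,U_3).$$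
   Context: Sequential warped product: let $(M_i,g_i)$, $i=1,2,3$, be Riemannian manifolds of dimension $m_i$, and let $f:M_1\to(0,\infty)$ and $h:M_1\times M_2\to(0,\infty)$ be smooth. $\overline{M}=(M_1\times_f M_2)\times_h M_3$ is $M_1\times M_2\times M_3$ with metric $\overline{g}=g_1\oplus f^2g_2\oplus h^2g_3$. $\overline{Ric}$, $Ric^i$ are the Ricci tensors of $\overline{M}$, $M_i$; $\chi(M_i)$ denotes vector fields on $M_i$, identified with their lifts to $\overline{M}$. $grad^1f$, $H_1^f$, $\Delta^1f$ are the gradient, Hessian and Laplacian (trace of the Hessian) of $f$ on $(M_1,g_1)$; $grad\,h$, $H^h$, $\Delta h$ are the gradient, Hessian and Laplacian (trace of the Hessian) of $h$ on $M_1\times_f M_2$, i.e. $M_1\times M_2$ with metric $g_1\oplus f^2g_2$; norms are taken in the corresponding metrics. Quasi-Einstein: a Riemannian manifold $(M,g)$ of dimension $n>2$ is quasi-Einstein if $Ric(X,Y)=\alpha g(X,Y)+\beta A(X)A(Y)$, where $\alpha,\beta$ are differentiable functions on $M$ with $\beta\neq 0$ and $A$ is a non-zero 1-form with $A(X)=g(X,U)$ for a unit vector field $U$. *)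

theory Defs
  imports "HOL-Analysis.Analysis"
begin

text \<open>
  A manifold is a topological space (a type) with a smooth atlas modelled on a Euclidean space
  \<open>'e\<close>, so that its dimension is \<open>DIM('e)\<close>.  As in Mathlib's charted spaces, the structure also
  records a preferred chart around every point.  It identifies the tangent space at that point
  with \<open>'e\<close>: the value \<open>X p :: 'e\<close> of a vector field consists of its components
  in the preferred chart at \<open>p\<close>, and its components in any other chart are obtained by applying
  the derivative of the transition map.
\<close>

datatype ('a, 'e) chart = Chart (chart_dom: "'a set") (chart_map: "'a \<Rightarrow> 'e")

datatype ('a, 'e) manifold =
  Manifold (atlas: "('a, 'e) chart set") (chart_at: "'a \<Rightarrow> ('a, 'e) chart")

definition chart_inv :: "('a, 'e) chart \<Rightarrow> 'e \<Rightarrow> 'a" where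
  "chart_inv c = inv_into (chart_dom c) (chart_map c)"

definition chart_img :: "('a, 'e) chart \<Rightarrow> 'e set" where
  "chart_img c = chart_map c ` chart_dom c"

abbreviation ddir :: "('e::real_normed_vector \<Rightarrow> 'f::real_normed_vector) \<Rightarrow> 'e \<Rightarrow> 'e \<Rightarrow> 'f" where
  "ddir F x v \<equiv> frechet_derivative F (at x) v"

text \<open>Only used for open \<open>S\<close>: \<open>F\<close> is of class \<open>C^k\<close>, respectively \<open>C^\<infinity>\<close>, on \<open>S\<close>.\<close>

primrec Ck_on :: "nat \<Rightarrow> 'e::euclidean_space set \<Rightarrow> ('e \<Rightarrow> 'f::real_normed_vector) \<Rightarrow> bool" where
  "Ck_on 0 S F = continuous_on S F"
| "Ck_on (Suc k) S F =
     ((\<forall>x\<in>S. F differentiable at x) \<and> (\<forall>v. Ck_on k S (\<lambda>x. ddir F x v)))"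

definition smooth_on :: "'e::euclidean_space set \<Rightarrow> ('e \<Rightarrow> 'f::real_normed_vector) \<Rightarrow> bool" where
  "smooth_on S F \<longleftrightarrow> (\<forall>k. Ck_on k S F)"

definition smooth_manifold ::
    "('a::{t2_space,second_countable_topology}, 'e::euclidean_space) manifold \<Rightarrow> bool" where
  "smooth_manifold M \<longleftrightarrow>
     (\<forall>c\<in>atlas M. open (chart_dom c) \<and> open (chart_img c) \<and>
        homeomorphism (chart_dom c) (chart_img c) (chart_map c) (chart_inv c)) \<and>
     (\<forall>c\<in>atlas M. \<forall>d\<in>atlas M.
        smooth_on (chart_map c ` (chart_dom c \<inter> chart_dom d)) (chart_map d \<circ> chart_inv c)) \<and>
     (\<forall>p. chart_at M p \<in> atlas M \<and> p \<in> chart_dom (chart_at M p))"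

definition prod_chart :: "('a, 'e) chart \<Rightarrow> ('b, 'f) chart \<Rightarrow> ('a \<times> 'b, 'e \<times> 'f) chart" where
  "prod_chart c d = Chart (chart_dom c \<times> chart_dom d) (map_prod (chart_map c) (chart_map d))"

text \<open>
  The preferred charts of the product are product charts, so a tangent vector at \<open>(p, q)\<close> is
  the pair of its components tangent to the two factors, and the lifts of vector fields \<open>X\<close> and
  \<open>Y\<close> on the factors are \<open>\<lambda>(p, q). (X p, 0)\<close> and \<open>\<lambda>(p, q). (0, Y q)\<close>.
\<close>

definition prod_manifold ::
    "('a, 'e) manifold \<Rightarrow> ('b, 'f) manifold \<Rightarrow> ('a \<times> 'b, 'e \<times> 'f) manifold" where
  "prod_manifold M N =
     Manifold {prod_chart c d | c d. c \<in> atlas M \<and> d \<in> atlas N}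
       (\<lambda>(p, q). prod_chart (chart_at M p) (chart_at N q))"

definition tangent_change ::
    "('a, 'e::euclidean_space) chart \<Rightarrow> ('a, 'e) chart \<Rightarrow> 'a \<Rightarrow> 'e \<Rightarrow> 'e" where
  "tangent_change c d p v = ddir (chart_map d \<circ> chart_inv c) (chart_map c p) v"

definition smooth_function :: "('a, 'e::euclidean_space) manifold \<Rightarrow> ('a \<Rightarrow> real) \<Rightarrow> bool" where
  "smooth_function M F \<longleftrightarrow> (\<forall>c\<in>atlas M. smooth_on (chart_img c) (F \<circ> chart_inv c))"

definition differentiable_function ::
    "('a, 'e::euclidean_space) manifold \<Rightarrow> ('a \<Rightarrow> real) \<Rightarrow> bool" where
  "differentiable_function M F \<longleftrightarrow>
     (\<forall>c\<in>atlas M. \<forall>x\<in>chart_img c. (F \<circ> chart_inv c) differentiable at x)"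

definition vector_field :: "('a, 'e::euclidean_space) manifold \<Rightarrow> ('a \<Rightarrow> 'e) \<Rightarrow> bool" where
  "vector_field M X \<longleftrightarrow>
     (\<forall>c\<in>atlas M. smooth_on (chart_img c)
        (\<lambda>x. let p = chart_inv c x in tangent_change (chart_at M p) c p (X p)))"

type_synonym ('a, 'e) metric = "'a \<Rightarrow> 'e \<Rightarrow> 'e \<Rightarrow> real"

text \<open>The metric in the coordinates \<open>x\<close> of the chart \<open>c\<close>.\<close>

definition local_metric ::
    "('a, 'e::euclidean_space) manifold \<Rightarrow> ('a, 'e) metric \<Rightarrow> ('a, 'e) chart \<Rightarrow> ('e, 'e) metric" where
  "local_metric M g c x v w =
     (let p = chart_inv c x; T = tangent_change c (chart_at M p) p in g p (T v) (T w))"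

definition riemannian_manifold ::
    "('a::{t2_space,second_countable_topology}, 'e::euclidean_space) manifold
      \<Rightarrow> ('a, 'e) metric \<Rightarrow> bool" where
  "riemannian_manifold M g \<longleftrightarrow>
     smooth_manifold M \<and>
     (\<forall>p. bilinear (g p)) \<and> (\<forall>p v w. g p v w = g p w v) \<and> (\<forall>p v. v \<noteq> 0 \<longrightarrow> g p v v > 0) \<and>
     (\<forall>c\<in>atlas M. \<forall>v w. smooth_on (chart_img c) (\<lambda>x. local_metric M g c x v w))"

text \<open>The vector dual to the linear form \<open>\<phi>\<close> with respect to the inner product \<open>B\<close>.\<close>

definition raise_index :: "('e \<Rightarrow> 'e \<Rightarrow> real) \<Rightarrow> ('e \<Rightarrow> real) \<Rightarrow> 'e" where
  "raise_index B \<phi> = (THE z. \<forall>w. B z w = \<phi> w)"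

text \<open>Trace of a linear map.\<close>

definition tr :: "('e::euclidean_space \<Rightarrow> 'e) \<Rightarrow> real" where
  "tr L = (\<Sum>b\<in>Basis. L b \<bullet> b)"

text \<open>
  For a metric \<open>G\<close> in coordinates, the Levi-Civita connection is
  \<open>\<nabla>\<^sub>u Y = ddir Y x u + christoffel G x u (Y x)\<close>; for constant \<open>u\<close>, \<open>v\<close>, \<open>w\<close> the Christoffel
  term is given by the Koszul formula.  The curvature is
  \<open>R(u,v)w = \<nabla>\<^sub>u \<nabla>\<^sub>v w - \<nabla>\<^sub>v \<nabla>\<^sub>u w\<close> and \<open>Ric(v,w)\<close> is the trace of \<open>u \<mapsto> R(u,v)w\<close>, so that round
  spheres have positive Ricci curvature.
\<close>

definition christoffel :: "('e::euclidean_space, 'e) metric \<Rightarrow> 'e \<Rightarrow> 'e \<Rightarrow> 'e \<Rightarrow> 'e" where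
  "christoffel G x u v = raise_index (G x)
     (\<lambda>w. (ddir (\<lambda>y. G y v w) x u + ddir (\<lambda>y. G y u w) x v - ddir (\<lambda>y. G y u v) x w) / 2)"

definition local_curvature :: "('e::euclidean_space, 'e) metric \<Rightarrow> 'e \<Rightarrow> 'e \<Rightarrow> 'e \<Rightarrow> 'e \<Rightarrow> 'e" where
  "local_curvature G x u v w =
     ddir (\<lambda>y. christoffel G y v w) x u - ddir (\<lambda>y. christoffel G y u w) x v
     + christoffel G x u (christoffel G x v w) - christoffel G x v (christoffel G x u w)"

definition local_ricci :: "('e::euclidean_space, 'e) metric \<Rightarrow> 'e \<Rightarrow> 'e \<Rightarrow> 'e \<Rightarrow> real" where
  "local_ricci G x v w = tr (\<lambda>u. local_curvature G x u v w)"

text \<open>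
  The tensors below are evaluated at \<open>p\<close> in the preferred chart at \<open>p\<close>, in which the components
  of tangent vectors at \<open>p\<close> are given.
\<close>

definition ricci ::
    "('a, 'e::euclidean_space) manifold \<Rightarrow> ('a, 'e) metric \<Rightarrow> 'a \<Rightarrow> 'e \<Rightarrow> 'e \<Rightarrow> real" where
  "ricci M g p v w =
     (let c = chart_at M p in local_ricci (local_metric M g c) (chart_map c p) v w)"

definition differential ::
    "('a, 'e::euclidean_space) manifold \<Rightarrow> ('a \<Rightarrow> real) \<Rightarrow> 'a \<Rightarrow> 'e \<Rightarrow> real" where
  "differential M F p v =
     (let c = chart_at M p in ddir (F \<circ> chart_inv c) (chart_map c p) v)"

definition grad ::
    "('a, 'e::euclidean_space) manifold \<Rightarrow> ('a, 'e) metric \<Rightarrow> ('a \<Rightarrow> real) \<Rightarrow> 'a \<Rightarrow> 'e" where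
  "grad M g F p = raise_index (g p) (differential M F p)"

definition metric_norm :: "('a, 'e) metric \<Rightarrow> 'a \<Rightarrow> 'e \<Rightarrow> real" where
  "metric_norm g p v = sqrt (g p v v)"

text \<open>\<open>H(X,Y) = X(Y F) - (\<nabla>\<^sub>X Y) F\<close>, evaluated on fields that are constant in the chart.\<close>

definition hessian ::
    "('a, 'e::euclidean_space) manifold \<Rightarrow> ('a, 'e) metric \<Rightarrow> ('a \<Rightarrow> real)
      \<Rightarrow> 'a \<Rightarrow> 'e \<Rightarrow> 'e \<Rightarrow> real" where
  "hessian M g F p v w =
     (let c = chart_at M p; x = chart_map c p; F' = F \<circ> chart_inv c
      in ddir (\<lambda>y. ddir F' y w) x v - ddir F' x (christoffel (local_metric M g c) x v w))"

text \<open>The trace of the Hessian with respect to the metric.\<close>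

definition laplacian ::
    "('a, 'e::euclidean_space) manifold \<Rightarrow> ('a, 'e) metric \<Rightarrow> ('a \<Rightarrow> real) \<Rightarrow> 'a \<Rightarrow> real" where
  "laplacian M g F p = tr (\<lambda>v. raise_index (g p) (hessian M g F p v))"

definition warped_metric ::
    "('a, 'e) metric \<Rightarrow> ('a \<Rightarrow> real) \<Rightarrow> ('b, 'f) metric \<Rightarrow> ('a \<times> 'b, 'e \<times> 'f) metric" where
  "warped_metric g f g' =
     (\<lambda>(p, q) (v, v') (w, w'). g p v w + (f p)\<^sup>2 * g' q v' w')"

text \<open>
  For \<open>\<beta>\<close>, being non-zero means not vanishing identically, and \<open>\<alpha>\<close>, \<open>\<beta>\<close> need only be
  differentiable; this includes the readings with nowhere vanishing \<open>\<beta>\<close> or smooth \<open>\<alpha>\<close>, \<open>\<beta>\<close>.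
\<close>

definition quasi_einstein ::
    "('a::{t2_space,second_countable_topology}, 'e::euclidean_space) manifold \<Rightarrow> ('a, 'e) metric
      \<Rightarrow> ('a \<Rightarrow> real) \<Rightarrow> ('a \<Rightarrow> real) \<Rightarrow> ('a \<Rightarrow> 'e \<Rightarrow> real) \<Rightarrow> ('a \<Rightarrow> 'e) \<Rightarrow> bool" where
  "quasi_einstein M g \<alpha> \<beta> A U \<longleftrightarrow>
     DIM('e) > 2 \<and>
     differentiable_function M \<alpha> \<and> differentiable_function M \<beta> \<and> \<beta> \<noteq> (\<lambda>p. 0) \<and>
     vector_field M U \<and> (\<forall>p. metric_norm g p (U p) = 1) \<and>
     A \<noteq> (\<lambda>p v. 0) \<and> (\<forall>p v. A p v = g p v (U p)) \<and>
     (\<forall>X Y. vector_field M X \<longrightarrow> vector_field M Y \<longrightarrow>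
        (\<forall>p. ricci M g p (X p) (Y p) =
           \<alpha> p * g p (X p) (Y p) + \<beta> p * A p (X p) * A p (Y p)))"

end

theory Submission
  imports Defs
begin

text \<open>
  The statement follows from two applications, to \<open>(M\<^sub>1 \<times>\<^sub>f M\<^sub>2) \<times>\<^sub>h M\<^sub>3\<close> and to \<open>M\<^sub>1 \<times>\<^sub>f M\<^sub>2\<close>, of the
  formulas for the Ricci tensor of a warped product with an \<open>n\<close>-dimensional fibre on two vectors
  that are both tangent to the base or both tangent to the fibre:
  \<open>Ric(X,Y) = Ric\<^sub>M(X,Y) - (n/f) H\<^sup>f(X,Y)\<close> and
  \<open>Ric(V,W) = Ric\<^sub>N(V,W) - (f \<Delta>f + (n - 1) \<bar>grad f\<bar>\<^sup>2) g\<^sub>N(V,W)\<close>.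
  They are computed in product charts.  By the Koszul formula the Christoffel term of the warped
  metric is
  \<open>\<Gamma>((u,u'),(v,v')) = (\<Gamma>\<^sub>M(u,v) - f g\<^sub>N(u',v') grad f, \<Gamma>\<^sub>N(u',v') + (df(u)/f) v' + (df(v)/f) u')\<close>,
  and for the trace of \<open>u \<mapsto> R(u,v)w\<close> only the two diagonal blocks of this map are needed.
  Inserting lifts of vector fields on the factors into the quasi-Einstein equation gives the claim.
\<close>

subsection \<open>Smooth functions\<close>

text \<open>Two functions that agree on an open set have the same derivative at each of its points.
  Hence their directional derivatives agree on \<open>S\<close> as well, and the induction, with
  \<open>F\<close> and \<open>G\<close> generalized, goes on.\<close>

lemma Ck_on_cong:
  fixes F G :: "'e::euclidean_space \<Rightarrow> 'f::real_normed_vector"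
  assumes "open S" "\<And>x. x \<in> S \<Longrightarrow> F x = G x" "Ck_on k S F"
  shows "Ck_on k S G"
  using assms(2,3)
proof (induction k arbitrary: F G)
  case 0
  then show ?case by (auto cong: continuous_on_cong)
next
  case (Suc k)
  have der: "(G has_derivative ddir F x) (at x)" if "x \<in> S" for x
    using Suc.prems that assms(1)
    by (auto simp: frechet_derivative_works intro: has_derivative_transform_within_open)
  have "Ck_on k S (\<lambda>x. ddir G x v)" for v
    by (rule Suc.IH[of "\<lambda>x. ddir F x v"])
      (use Suc.prems in \<open>auto simp: frechet_derivative_at[OF der, symmetric]\<close>)
  then show ?case using der by (auto simp: differentiable_def)
qed

text \<open>Allows an explicit derivative \<open>F'\<close> in place of \<open>ddir F\<close>, so
  that each closure property below reduces to a differentiation rule and the induction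
  hypothesis.\<close>

lemma Ck_on_SucI:
  assumes "open S" and der: "\<And>x. x \<in> S \<Longrightarrow> (F has_derivative F' x) (at x)"
    and "\<And>v. Ck_on k S (\<lambda>x. F' x v)"
  shows "Ck_on (Suc k) S F"
proof -
  have "Ck_on k S (\<lambda>x. ddir F x v)" for v
    by (rule Ck_on_cong[OF assms(1) _ assms(3)[of v]]) (simp add: frechet_derivative_at[OF der, symmetric])
  then show ?thesis using der by (auto simp: differentiable_def)
qed

text \<open>Differentiability yields continuity in the base case. The product rule leaves
  undifferentiated factors, and this lowers their order to match.\<close>

lemma Ck_on_SucD: "Ck_on (Suc k) S F \<Longrightarrow> Ck_on k S F"
proof (induction k arbitrary: F)
  case 0
  then show ?case
    by (auto intro!: differentiable_imp_continuous_on differentiable_at_imp_differentiable_on)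
next
  case (Suc k)
  then show ?case by (metis Ck_on.simps(2))
qed

lemma Ck_on_has_derivative:
  "Ck_on (Suc k) S F \<Longrightarrow> x \<in> S \<Longrightarrow> (F has_derivative ddir F x) (at x)"
  by (auto simp: frechet_derivative_works)

lemma Ck_on_add:
  assumes "open S" "Ck_on k S F" "Ck_on k S G"
  shows "Ck_on k S (\<lambda>x. F x + G x)"
  using assms(2,3)
proof (induction k arbitrary: F G)
  case 0
  then show ?case by (auto intro: continuous_intros)
next
  case (Suc k)
  note der = Ck_on_has_derivative[OF Suc.prems(1)] Ck_on_has_derivative[OF Suc.prems(2)]
  have C: "Ck_on k S (\<lambda>x. ddir F x v + ddir G x v)" for v
    using Suc by simp
  have D: "((\<lambda>x. F x + G x) has_derivative (\<lambda>v. ddir F x v + ddir G x v)) (at x)" if "x \<in> S" for x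
    by (rule has_derivative_add[OF der]) (use that in simp_all)
  show ?case
    by (rule Ck_on_SucI[where F' = "\<lambda>x v. ddir F x v + ddir G x v", OF assms(1)]) (fact D, fact C)
qed

lemma Ck_on_mult:
  fixes F G :: "'e::euclidean_space \<Rightarrow> real"
  assumes "open S" "Ck_on k S F" "Ck_on k S G"
  shows "Ck_on k S (\<lambda>x. F x * G x)"
  using assms(2,3)
proof (induction k arbitrary: F G)
  case 0
  then show ?case by (auto intro: continuous_intros)
next
  case (Suc k)
  note der = Ck_on_has_derivative[OF Suc.prems(1)] Ck_on_has_derivative[OF Suc.prems(2)]
  have C: "Ck_on k S (\<lambda>x. F x * ddir G x v + ddir F x v * G x)" for v
    using Suc.prems
    by (intro Ck_on_add[OF assms(1)] Suc.IH Ck_on_SucD[OF Suc.prems(1)] Ck_on_SucD[OF Suc.prems(2)])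
      simp_all
  have D: "((\<lambda>x. F x * G x) has_derivative (\<lambda>v. F x * ddir G x v + ddir F x v * G x)) (at x)" if "x \<in> S" for x
    by (rule has_derivative_mult[OF der]) (use that in simp_all)
  show ?case
    by (rule Ck_on_SucI[where F' = "\<lambda>x v. F x * ddir G x v + ddir F x v * G x", OF assms(1)]) (fact D, fact C)
qed

lemma Ck_on_linear:
  assumes "open S" "bounded_linear L" "Ck_on k S F"
  shows "Ck_on k S (\<lambda>x. L (F x))"
  using assms(3)
proof (induction k arbitrary: F)
  case 0
  then show ?case by (auto intro: bounded_linear.continuous_on assms)
next
  case (Suc k)
  note der = Ck_on_has_derivative[OF Suc.prems]
  have C: "Ck_on k S (\<lambda>x. L (ddir F x v))" for v
    using Suc by simp
  have D: "((\<lambda>x. L (F x)) has_derivative (\<lambda>v. L (ddir F x v))) (at x)" if "x \<in> S" for x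
    by (rule bounded_linear.has_derivative[OF assms(2) der]) (use that in simp_all)
  show ?case
    by (rule Ck_on_SucI[where F' = "\<lambda>x v. L (ddir F x v)", OF assms(1)]) (fact D, fact C)
qed

text \<open>For linear \<open>L\<close> the chain rule gives the derivative of \<open>F\<close> at
  \<open>L x\<close> in the fixed direction \<open>L v\<close>, again a function composed with
  \<open>L\<close>, to which the induction hypothesis applies.\<close>

lemma Ck_on_compose_linear:
  assumes "open S" "open T" "bounded_linear L" "L ` T \<subseteq> S" "Ck_on k S F"
  shows "Ck_on k T (\<lambda>x. F (L x))"
  using assms(5)
proof (induction k arbitrary: F)
  case 0
  then show ?case
    using continuous_on_compose2[OF _ linear_continuous_on[OF assms(3)] assms(4)] by auto
next
  case (Suc k)
  have D: "((\<lambda>x. F (L x)) has_derivative (\<lambda>v. ddir F (L x) (L v))) (at x)" if "x \<in> T" for x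
    using has_derivative_compose[OF bounded_linear_imp_has_derivative[OF assms(3)]
        Ck_on_has_derivative[OF Suc.prems, of "L x"]] that assms(4) by auto
  have C: "Ck_on k T (\<lambda>x. ddir F (L x) (L v))" for v
    using Suc.IH[of "\<lambda>x. ddir F x (L v)"] Suc.prems by simp
  show ?case
    by (rule Ck_on_SucI[where F' = "\<lambda>x v. ddir F (L x) (L v)", OF assms(2)]) (fact D, fact C)
qed

lemma smooth_on_transform:
  "open S \<Longrightarrow> smooth_on S F \<Longrightarrow> (\<And>x. x \<in> S \<Longrightarrow> F x = G x) \<Longrightarrow> smooth_on S G"
  unfolding smooth_on_def using Ck_on_cong[of S F G] by simp

lemma smooth_on_add: "open S \<Longrightarrow> smooth_on S F \<Longrightarrow> smooth_on S G \<Longrightarrow> smooth_on S (\<lambda>x. F x + G x)"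
  unfolding smooth_on_def using Ck_on_add[of S _ F G] by simp

lemma smooth_on_mult:
  fixes F G :: "'e::euclidean_space \<Rightarrow> real"
  shows "open S \<Longrightarrow> smooth_on S F \<Longrightarrow> smooth_on S G \<Longrightarrow> smooth_on S (\<lambda>x. F x * G x)"
  unfolding smooth_on_def using Ck_on_mult[of S _ F G] by simp

lemma smooth_on_linear:
  "open S \<Longrightarrow> bounded_linear L \<Longrightarrow> smooth_on S F \<Longrightarrow> smooth_on S (\<lambda>x. L (F x))"
  unfolding smooth_on_def using Ck_on_linear[of S L _ F] by simp

lemma smooth_on_compose_fst:
  "open S \<Longrightarrow> open T \<Longrightarrow> smooth_on S F \<Longrightarrow> smooth_on (S \<times> T) (\<lambda>z. F (fst z))"
  unfolding smooth_on_def
  using Ck_on_compose_linear[of S "S \<times> T" fst _ F] by (auto simp: open_Times bounded_linear_fst)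

lemma smooth_on_compose_snd:
  "open S \<Longrightarrow> open T \<Longrightarrow> smooth_on T F \<Longrightarrow> smooth_on (S \<times> T) (\<lambda>z. F (snd z))"
  unfolding smooth_on_def
  using Ck_on_compose_linear[of T "S \<times> T" snd _ F] by (auto simp: open_Times bounded_linear_snd)

lemma smooth_on_map_prod:
  assumes "open S" "open T" "smooth_on S F" "smooth_on T G"
  shows "smooth_on (S \<times> T) (map_prod F G)"
proof (rule smooth_on_transform)
  \<comment> \<open>The pair is split into a sum of two linear embeddings, so closure under sums and
    linear maps suffices.\<close>
  show "smooth_on (S \<times> T) (\<lambda>z. (\<lambda>u. (u, 0)) (F (fst z)) + (\<lambda>v. (0, v)) (G (snd z)))"
    by (intro smooth_on_add smooth_on_linear[where L = "\<lambda>u. (u, 0)"] smooth_on_linear[where L = "\<lambda>v. (0, v)"]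
        smooth_on_compose_fst smooth_on_compose_snd open_Times assms)
      (auto intro!: bounded_linear_Pair bounded_linear_ident bounded_linear_zero)
qed (use assms in \<open>auto intro: open_Times\<close>)

lemma smooth_on_has_derivative:
  "smooth_on S F \<Longrightarrow> x \<in> S \<Longrightarrow> (F has_derivative ddir F x) (at x)"
  unfolding smooth_on_def by (meson Ck_on_has_derivative)

lemma smooth_on_ddir: "smooth_on S F \<Longrightarrow> smooth_on S (\<lambda>x. ddir F x v)"
  unfolding smooth_on_def
  using Ck_on.simps(2)[of _ S F] by blast

lemma ddir_eqI: "(F has_derivative F') (at x) \<Longrightarrow> ddir F x = F'"
  using frechet_derivative_at by metis

subsection \<open>Raising indices\<close>

definition inner_form :: "('e::euclidean_space \<Rightarrow> 'e \<Rightarrow> real) \<Rightarrow> bool" where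
  "inner_form B \<longleftrightarrow> bilinear B \<and> (\<forall>v w. B v w = B w v) \<and> (\<forall>v. v \<noteq> 0 \<longrightarrow> B v v > 0)"

text \<open>Positivity is applied to \<open>z - z'\<close>. Most vector identities below are proved
  this way, by pairing both sides with an arbitrary vector.\<close>

lemma inner_form_eqI:
  assumes "inner_form B" "\<And>w. B z w = B z' w"
  shows "z = z'"
proof -
  have "B (z - z') (z - z') = B z (z - z') - B z' (z - z')"
    using assms(1) bilinear_lsub by (auto simp: inner_form_def)
  also have "\<dots> = 0"
    by (simp add: assms(2)[of "z - z'"])
  finally show ?thesis
    using assms(1) unfolding inner_form_def by (metis less_irrefl right_minus_eq)
qed

lemma raise_index_unique:
  assumes "inner_form B" "\<And>w. B z w = \<phi> w"
  shows "raise_index B \<phi> = z"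
  unfolding raise_index_def
proof (rule the_equality)
  show "z' = z" if "\<forall>w. B z' w = \<phi> w" for z'
    using that assms by (intro inner_form_eqI[of B]) auto
qed (use assms in blast)

text \<open>The map \<open>K\<close> sends \<open>v\<close> to the coordinates of
  \<open>B v\<close>. It is injective because \<open>B\<close> is nondegenerate, hence surjective in
  finite dimension.\<close>

lemma raise_index_exists:
  fixes B :: "'e::euclidean_space \<Rightarrow> 'e \<Rightarrow> real"
  assumes "inner_form B" "linear \<phi>"
  obtains z where "\<And>w. B z w = \<phi> w"
proof -
  define K where "K v = (\<Sum>b\<in>Basis. B v b *\<^sub>R b)" for v
  have bil: "bilinear B" using assms by (auto simp: inner_form_def)
  have "linear K"
    unfolding K_def linear_iff
    using bil by (simp add: bilinear_ladd bilinear_lmul scaleR_add_left sum.distrib scaleR_sum_right)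
  have K: "K v \<bullet> b = B v b" if "b \<in> Basis" for v b
    using that by (simp add: K_def)
  have "inj K"
  proof (rule injI)
    fix v v' assume "K v = K v'"
    then have "B v b = B v' b" if "b \<in> Basis" for b
      using K that by metis
    then have "B v w = B v' w" for w
      using linear_eq_stdbasis[of "B v" "B v'"] bil by (auto simp: bilinear_def)
    then show "v = v'" using assms(1) inner_form_eqI by blast
  qed
  then have "surj K" using \<open>linear K\<close> linear_injective_imp_surjective by blast
  then obtain z where z: "K z = (\<Sum>b\<in>Basis. \<phi> b *\<^sub>R b)" by (metis surjD)
  have "B z b = \<phi> b" if "b \<in> Basis" for b
    using K[OF that, of z] that by (simp add: z)
  then have "B z w = \<phi> w" for w
    using linear_eq_stdbasis[of "B z" \<phi>] bil assms(2) by (auto simp: bilinear_def)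
  then show ?thesis using that by blast
qed

lemma raise_index:
  assumes "inner_form B" "linear \<phi>"
  shows "B (raise_index B \<phi>) w = \<phi> w"
  using raise_index_exists[OF assms] raise_index_unique[OF assms(1)] by metis

section \<open>Differentiable dependence of the raised vector on the inner product\<close>

text \<open>Write the product as \<open>a y * s x + a y * (s y - s x)\<close>. Since
  \<open>a\<close> vanishes at \<open>x\<close>, \<open>a y\<close> is of order
  \<open>norm (y - x)\<close>, and the other factor of the second term tends to 0 by continuity. So
  that term has derivative 0.\<close>

lemma has_derivative_mult_continuous:
  fixes a s :: "'p::real_normed_vector \<Rightarrow> real"
  assumes a: "(a has_derivative a') (at x)" and "a x = 0" and s: "isCont s x"
  shows "((\<lambda>y. a y * s y) has_derivative (\<lambda>u. a' u * s x)) (at x)"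
proof -
  have bl: "bounded_linear a'" using a by (rule has_derivative_bounded_linear)
  obtain K where K: "K > 0" "\<And>u. norm (a' u) \<le> norm u * K"
    using bounded_linear.pos_bounded[OF bl] by blast
  have ev: "\<forall>\<^sub>F y in at x. norm (a y - a' (y - x)) \<le> e * norm (y - x)" if "e > 0" for e
    using a that \<open>a x = 0\<close> by (simp add: has_derivative_within_alt2)
  have "((\<lambda>y. a y * (s y - s x)) has_derivative (\<lambda>u. 0)) (at x)"
    unfolding has_derivative_within_alt2
  proof (intro conjI allI impI)
    fix e :: real assume e: "e > 0"
    \<comment> \<open>The divisor \<open>1 + K\<close> matches the bound
      \<open>\<bar>a y\<bar> \<le> (1 + K) * norm (y - x)\<close> derived below from the error bound
      with constant 1.\<close>
    then have "\<forall>\<^sub>F y in at x. dist (s y) (s x) < e / (1 + K)"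
      using s K by (intro tendstoD) (auto simp: isCont_def)
    then show "\<forall>\<^sub>F y in at x. norm (a y * (s y - s x) - a x * (s x - s x) - 0) \<le> e * norm (y - x)"
      using ev[of 1, simplified]
    proof eventually_elim
      case (elim y)
      have "\<bar>a y\<bar> \<le> \<bar>a y - a' (y - x)\<bar> + \<bar>a' (y - x)\<bar>" by simp
      also have "\<dots> \<le> norm (y - x) + norm (y - x) * K"
        using elim(2) K(2)[of "y - x"] by simp
      also have "\<dots> = (1 + K) * norm (y - x)"
        by (simp add: algebra_simps)
      finally have "\<bar>a y\<bar> * \<bar>s y - s x\<bar> \<le> ((1 + K) * norm (y - x)) * (e / (1 + K))"
        using elim(1) K(1) e by (intro mult_mono) (auto simp: dist_real_def)
      also have "\<dots> = e * norm (y - x)"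
        using K(1) by (simp add: field_simps)
      finally show ?case by (simp add: abs_mult)
    qed
  qed simp
  from has_derivative_add[OF this has_derivative_mult_left[OF a, of "s x"]]
  show ?thesis by (simp add: algebra_simps)
qed

text \<open>Christoffel terms and gradients are given only implicitly, by raising an index. This
  makes them differentiable, as is required for computing curvature and Hessians.\<close>

lemma raise_index_differentiable:
  fixes G :: "'p::real_normed_vector \<Rightarrow> 'e::euclidean_space \<Rightarrow> 'e \<Rightarrow> real"
  assumes S: "open S" "x \<in> S" and G: "\<And>y. y \<in> S \<Longrightarrow> inner_form (G y)"
    and \<phi>: "\<And>y. y \<in> S \<Longrightarrow> linear (\<phi> y)"
    and dG: "\<And>v w. (\<lambda>y. G y v w) differentiable (at x)"
    and d\<phi>: "\<And>w. (\<lambda>y. \<phi> y w) differentiable (at x)"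
  shows "(\<lambda>y. raise_index (G y) (\<phi> y)) differentiable (at x)"
proof -
  define z where "z y = raise_index (G y) (\<phi> y)" for y
  \<comment> \<open>The \<open>e b\<close> are the basis dual to \<open>Basis\<close> under
    \<open>G x\<close>, so \<open>k y\<close> is \<open>\<phi> y\<close> raised with the fixed form
    \<open>G x\<close>. The remainder \<open>r y\<close> is bounded by
    \<open>q y * norm (z y)\<close>.\<close>
  define e where "e b = raise_index (G x) (\<lambda>w. b \<bullet> w)" for b
  define k where "k y = (\<Sum>b\<in>Basis. \<phi> y b *\<^sub>R e b)" for y
  define a where "a c b y = G y c b - G x c b" for c b y
  define r where "r y = (\<Sum>b\<in>Basis. \<Sum>c\<in>Basis. (a c b y * (z y \<bullet> c)) *\<^sub>R e b)" for y
  define q where "q y = (\<Sum>b\<in>Basis. \<Sum>c\<in>Basis. \<bar>a c b y\<bar> * norm (e b))" for y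
  have Gx: "inner_form (G x)" and bil: "bilinear (G x)" using G S by (auto simp: inner_form_def)
  have z: "G y (z y) w = \<phi> y w" if "y \<in> S" for y w
    unfolding z_def by (rule raise_index[OF G \<phi>]) (use that in auto)
  have e: "G x (e b) w = b \<bullet> w" for b w
    unfolding e_def
    by (rule raise_index[OF Gx]) (simp add: bounded_linear.linear[OF bounded_linear_inner_right])
  \<comment> \<open>Raising the index with the fixed form \<open>G x\<close> instead of \<open>G y\<close> leaves a remainder with
    coefficients \<open>a\<close> vanishing at \<open>x\<close>.  So \<open>z\<close> is first seen to be bounded near \<open>x\<close>, then
    continuous at \<open>x\<close>, and then differentiable at \<open>x\<close>.\<close>
  have zsum: "z y = k y - r y" if y: "y \<in> S" for y
  proof -
    have bily: "bilinear (G y)" using G y by (auto simp: inner_form_def)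
    have exp: "B v b = (\<Sum>c\<in>Basis. (v \<bullet> c) * B c b)" if "bilinear B" for B :: "'e \<Rightarrow> 'e \<Rightarrow> real" and v b
    proof -
      have lin: "linear (\<lambda>v. B v b)" using that by (simp add: bilinear_def)
      have "B v b = B (\<Sum>c\<in>Basis. (v \<bullet> c) *\<^sub>R c) b" by (simp add: euclidean_representation)
      also have "\<dots> = (\<Sum>c\<in>Basis. (v \<bullet> c) * B c b)"
        using linear_sum[OF lin, of "\<lambda>c. (v \<bullet> c) *\<^sub>R c" Basis] that by (simp add: bilinear_lmul)
      finally show ?thesis .
    qed
    \<comment> \<open>From \<open>\<phi> y b = G y (z y) b\<close> the sum subtracts the
      contribution of \<open>G y - G x\<close>, expanded in \<open>Basis\<close>.\<close>
    have co: "\<phi> y b - (\<Sum>c\<in>Basis. a c b y * (z y \<bullet> c)) = G x (z y) b" for b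
      using z[OF y, of b]
      by (simp add: exp[OF bil, of "z y" b] exp[OF bily, of "z y" b] a_def algebra_simps sum_subtractf)
    have "k y - r y = (\<Sum>b\<in>Basis. (\<phi> y b - (\<Sum>c\<in>Basis. a c b y * (z y \<bullet> c))) *\<^sub>R e b)"
      by (simp add: k_def r_def sum_subtractf scaleR_diff_left scaleR_sum_left)
    also have "\<dots> = (\<Sum>b\<in>Basis. G x (z y) b *\<^sub>R e b)"
      by (simp only: co)
    also have "\<dots> = z y"
    proof (rule inner_form_eqI[OF Gx])
      fix w
      have "linear (\<lambda>v. G x v w)" using bil by (simp add: bilinear_def)
      then have "G x (\<Sum>b\<in>Basis. G x (z y) b *\<^sub>R e b) w = (\<Sum>b\<in>Basis. G x (z y) b * (b \<bullet> w))"
        using linear_sum[of "\<lambda>v. G x v w" "\<lambda>b. G x (z y) b *\<^sub>R e b" Basis]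
        by (simp add: bilinear_lmul[OF bil] e)
      also have "\<dots> = G x w (z y)"
        using exp[OF bil, of w "z y"] Gx by (simp add: inner_form_def inner_commute mult.commute)
      finally show "G x (\<Sum>b\<in>Basis. G x (z y) b *\<^sub>R e b) w = G x (z y) w"
        using Gx by (simp add: inner_form_def)
    qed
    finally show ?thesis by simp
  qed
  have dk: "k differentiable (at x)"
    unfolding k_def by (intro differentiable_sum ballI differentiable_scaleR d\<phi> finite_Basis) simp
  have da: "a c b differentiable (at x)" for c b
    unfolding a_def by (intro differentiable_diff dG) simp
  have a0: "a c b x = 0" for c b
    by (simp add: a_def)
  have r_le: "norm (r y) \<le> q y * norm (z y)" for y
    unfolding r_def q_def sum_distrib_right
    by (intro order_trans[OF norm_sum] sum_mono)
      (auto simp: abs_mult mult.assoc mult.commute[of _ "norm (e _)"] Basis_le_norm intro!: mult_left_mono)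
  have qx: "(q \<longlongrightarrow> 0) (at x)"
  proof -
    have "isCont q x"
      unfolding q_def using da
      by (intro continuous_intros) (auto intro: differentiable_imp_continuous_within)
    moreover have "q x = 0" by (simp add: q_def a0)
    ultimately show ?thesis by (simp add: isCont_def)
  qed
  have kx: "(k \<longlongrightarrow> k x) (at x)"
    using differentiable_imp_continuous_within[OF dk] by (simp add: isCont_def)
  have evS: "\<forall>\<^sub>F y in at x. y \<in> S"
    using S eventually_at_in_open' by blast
  \<comment> \<open>Once \<open>q y < 1/2\<close>, the remainder is at most half of
    \<open>norm (z y)\<close> and can be absorbed, which bounds \<open>z\<close> by
    \<open>2 * norm (k y)\<close>.\<close>
  have "\<forall>\<^sub>F y in at x. norm (z y - k y) \<le> q y * (2 * norm (k y))"
    using evS order_tendstoD(2)[OF qx, of "1/2", simplified]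
  proof eventually_elim
    case (elim y)
    have "0 \<le> q y" by (auto simp: q_def intro!: sum_nonneg)
    have "norm (z y) \<le> norm (k y) + norm (r y)"
      using zsum[OF elim(1)] norm_triangle_ineq4[of "k y" "r y"] by simp
    also have "norm (r y) \<le> 1/2 * norm (z y)"
      using elim(2) by (intro order_trans[OF r_le] mult_right_mono) auto
    finally have "norm (z y) \<le> 2 * norm (k y)" by simp
    then have "norm (r y) \<le> q y * (2 * norm (k y))"
      using r_le[of y] \<open>0 \<le> q y\<close> mult_left_mono order_trans by blast
    then show ?case using zsum[OF elim(1)] by simp
  qed
  moreover have "((\<lambda>y. q y * (2 * norm (k y))) \<longlongrightarrow> 0) (at x)"
    using tendsto_mult[OF qx tendsto_mult[OF tendsto_const tendsto_norm[OF kx]], of 2] by simp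
  ultimately have "((\<lambda>y. z y - k y) \<longlongrightarrow> 0) (at x)"
    by (rule Lim_null_comparison)
  from tendsto_add[OF this kx] have "(z \<longlongrightarrow> k x) (at x)" by simp
  moreover have "z x = k x"
    using zsum[OF S(2)] by (simp add: r_def a0)
  ultimately have cz: "isCont z x" by (simp add: isCont_def)
  \<comment> \<open>The coefficient vanishes at \<open>x\<close>, so the continuity of
    \<open>z\<close> just obtained makes the product differentiable.\<close>
  have "(\<lambda>y. a c b y * (z y \<bullet> c)) differentiable (at x)" for c b
    using has_derivative_mult_continuous[OF da[of c b, unfolded frechet_derivative_works] a0, of "\<lambda>y. z y \<bullet> c"]
      cz by (auto simp: differentiable_def)
  then have "(\<lambda>y. k y - r y) differentiable (at x)"
    unfolding r_def
    by (intro differentiable_diff dk differentiable_sum ballI differentiable_scaleR finite_Basis) auto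
  then obtain D where "((\<lambda>y. k y - r y) has_derivative D) (at x)"
    by (auto simp: differentiable_def)
  then have "(z has_derivative D) (at x)"
    by (rule has_derivative_transform_within_open[OF _ S]) (simp add: zsum)
  then show ?thesis
    using differentiableI unfolding z_def by blast
qed

subsection \<open>The Levi-Civita connection in coordinates\<close>

definition metric_on :: "'e::euclidean_space set \<Rightarrow> ('e, 'e) metric \<Rightarrow> bool" where
  "metric_on S G \<longleftrightarrow> open S \<and> (\<forall>x\<in>S. inner_form (G x)) \<and> (\<forall>v w. smooth_on S (\<lambda>x. G x v w))"

text \<open>Computes the derivative of a function whose closed formula is known only on an open set,
  such as the image of a chart.\<close>

lemma ddir_transform:
  assumes "open S" "x \<in> S" "(F has_derivative F') (at x)" "\<And>y. y \<in> S \<Longrightarrow> F y = H y"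
  shows "ddir H x = F'"
  by (rule ddir_eqI[OF has_derivative_transform_within_open[OF assms(3,1,2)]]) (rule assms(4))

context
  fixes S :: "'e::euclidean_space set" and G :: "('e, 'e) metric"
  assumes G: "metric_on S G"
begin

lemma metric_on_open: "open S"
  using G by (simp add: metric_on_def)

lemma metric_on_inner_form: "x \<in> S \<Longrightarrow> inner_form (G x)"
  using G by (simp add: metric_on_def)

lemma metric_on_bilinear: "x \<in> S \<Longrightarrow> bilinear (G x)"
  using metric_on_inner_form by (simp add: inner_form_def)

lemma metric_on_sym: "x \<in> S \<Longrightarrow> G x v w = G x w v"
  using metric_on_inner_form by (simp add: inner_form_def)

lemma metric_on_smooth: "smooth_on S (\<lambda>x. G x v w)"
  using G by (simp add: metric_on_def)

lemma metric_on_has_derivative: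
  "x \<in> S \<Longrightarrow> ((\<lambda>y. G y v w) has_derivative ddir (\<lambda>y. G y v w) x) (at x)"
  by (rule smooth_on_has_derivative[OF metric_on_smooth])

lemma ddir_metric_sym: "x \<in> S \<Longrightarrow> ddir (\<lambda>y. G y v w) x = ddir (\<lambda>y. G y w v) x"
  by (rule ddir_transform[OF metric_on_open _ metric_on_has_derivative]) (auto simp: metric_on_sym)

lemma linear_ddir_metric_right:
  assumes "x \<in> S"
  shows "linear (\<lambda>w. ddir (\<lambda>y. G y v w) x u)"
proof (rule linearI)
  note der = metric_on_has_derivative[OF assms]
  show "ddir (\<lambda>y. G y v (w + w')) x u = ddir (\<lambda>y. G y v w) x u + ddir (\<lambda>y. G y v w') x u" for w w'
    by (subst ddir_transform[OF metric_on_open assms has_derivative_add[OF der der]])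
      (auto simp: bilinear_radd[OF metric_on_bilinear])
  show "ddir (\<lambda>y. G y v (c *\<^sub>R w)) x u = c *\<^sub>R ddir (\<lambda>y. G y v w) x u" for c w
    by (subst ddir_transform[OF metric_on_open assms has_derivative_mult_right[OF der]])
      (auto simp: bilinear_rmul[OF metric_on_bilinear])
qed

lemma linear_ddir_metric_left:
  assumes "x \<in> S"
  shows "linear (\<lambda>v. ddir (\<lambda>y. G y v w) x u)"
  using linear_ddir_metric_right[OF assms, of w u] by (simp add: ddir_metric_sym[OF assms, of w])

lemma linear_ddir_metric:
  assumes "x \<in> S"
  shows "linear (ddir (\<lambda>y. G y v w) x)"
  using metric_on_has_derivative[OF assms] has_derivative_linear by blast

lemma koszul_linear:
  assumes "x \<in> S"
  shows "linear (\<lambda>w. (ddir (\<lambda>y. G y v w) x u + ddir (\<lambda>y. G y u w) x v - ddir (\<lambda>y. G y u v) x w) / 2)"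
  using linear_ddir_metric_right[OF assms, of v u] linear_ddir_metric_right[OF assms, of u v]
    linear_ddir_metric[OF assms, of u v]
  by (simp add: linear_iff field_simps)

lemma koszul:
  assumes "x \<in> S"
  shows "G x (christoffel G x u v) w =
    (ddir (\<lambda>y. G y v w) x u + ddir (\<lambda>y. G y u w) x v - ddir (\<lambda>y. G y u v) x w) / 2"
  unfolding christoffel_def
  by (rule raise_index[OF metric_on_inner_form[OF assms] koszul_linear[OF assms]])

lemma christoffel_sym: "x \<in> S \<Longrightarrow> christoffel G x u v = christoffel G x v u"
  by (rule inner_form_eqI[OF metric_on_inner_form]) (auto simp: koszul ddir_metric_sym[of x u v])

lemma linear_christoffel_right:
  assumes "x \<in> S"
  shows "linear (christoffel G x u)"
proof -
  note b = metric_on_bilinear[OF assms]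
  note l = linear_ddir_metric_left[OF assms] linear_ddir_metric_right[OF assms] linear_ddir_metric[OF assms]
  show ?thesis
  proof (rule linearI)
    show "christoffel G x u (v + v') = christoffel G x u v + christoffel G x u v'" for v v'
      by (rule inner_form_eqI[OF metric_on_inner_form[OF assms]])
        (simp add: bilinear_ladd[OF b] koszul[OF assms] linear_add[OF l(1)] linear_add[OF l(2)]
          linear_add[OF l(3)] field_simps)
    show "christoffel G x u (c *\<^sub>R v) = c *\<^sub>R christoffel G x u v" for c v
      by (rule inner_form_eqI[OF metric_on_inner_form[OF assms]])
        (simp add: bilinear_lmul[OF b] koszul[OF assms] linear_scale[OF l(1)] linear_scale[OF l(2)]
          linear_scale[OF l(3)] field_simps)
  qed
qed

lemma bilinear_christoffel:
  assumes "x \<in> S"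
  shows "bilinear (christoffel G x)"
proof -
  have "(\<lambda>u. christoffel G x u v) = christoffel G x v" for v
    using christoffel_sym[OF assms] by auto
  then show ?thesis
    using linear_christoffel_right[OF assms] by (simp add: bilinear_def)
qed

text \<open>In the sum of the Koszul formula and the one with \<open>v\<close> and \<open>w\<close>
  exchanged, the derivatives along \<open>v\<close> and \<open>w\<close> cancel.\<close>

lemma metric_compatible:
  assumes "x \<in> S"
  shows "ddir (\<lambda>y. G y v w) x u = G x (christoffel G x u v) w + G x v (christoffel G x u w)"
  using koszul[OF assms, of u v w] koszul[OF assms, of u w v] metric_on_sym[OF assms, of v]
    ddir_metric_sym[OF assms, of v w] ddir_metric_sym[OF assms, of u v] ddir_metric_sym[OF assms, of u w]
  by simp

lemma raise_index_metric_differentiable: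
  assumes "x \<in> S" "\<And>y. y \<in> S \<Longrightarrow> linear (\<phi> y)" "\<And>w. (\<lambda>y. \<phi> y w) differentiable (at x)"
  shows "(\<lambda>y. raise_index (G y) (\<phi> y)) differentiable (at x)"
  using metric_on_has_derivative[OF assms(1)]
  by (intro raise_index_differentiable[OF metric_on_open assms(1) metric_on_inner_form])
     (auto simp: assms(2,3) intro: differentiableI)

lemma christoffel_differentiable:
  assumes "x \<in> S"
  shows "(\<lambda>y. christoffel G y u v) differentiable (at x)"
proof -
  have "(\<lambda>y. ddir (\<lambda>y. G y a b) y c) differentiable (at x)" for a b c
    using smooth_on_has_derivative[OF smooth_on_ddir[OF metric_on_smooth] assms]
    by (auto simp: differentiable_def)
  then show ?thesis
    unfolding christoffel_def
    by (intro raise_index_metric_differentiable koszul_linear assms) (auto intro!: derivative_intros)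
qed

text \<open>Product rule for a moving argument, by expanding \<open>Z y\<close> in
  \<open>Basis\<close>. The first term freezes \<open>Z\<close> at \<open>x\<close> and
  differentiates only the metric.\<close>

lemma metric_has_derivative_left:
  assumes x: "x \<in> S" and Z: "(Z has_derivative Z') (at x)"
  shows "((\<lambda>y. G y (Z y) w) has_derivative (\<lambda>u. ddir (\<lambda>y. G y (Z x) w) x u + G x (Z' u) w)) (at x)"
proof -
  have exp: "l v = (\<Sum>b\<in>Basis. (v \<bullet> b) * l b)" if "linear l" for l :: "'e \<Rightarrow> real" and v
    using linear_sum[OF that, of "\<lambda>b. (v \<bullet> b) *\<^sub>R b" Basis]
    by (simp add: euclidean_representation linear_scale[OF that])
  have lG: "linear (\<lambda>v. G y v w)" if "y \<in> S" for y
    using metric_on_bilinear[OF that] by (simp add: bilinear_def)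
  have "((\<lambda>y. \<Sum>b\<in>Basis. (Z y \<bullet> b) * G y b w) has_derivative
      (\<lambda>u. \<Sum>b\<in>Basis. (Z x \<bullet> b) * ddir (\<lambda>y. G y b w) x u + (Z' u \<bullet> b) * G x b w)) (at x)"
    by (intro has_derivative_sum has_derivative_mult has_derivative_inner_left Z metric_on_has_derivative x)
  moreover have "(\<Sum>b\<in>Basis. (Z x \<bullet> b) * ddir (\<lambda>y. G y b w) x u + (Z' u \<bullet> b) * G x b w)
      = ddir (\<lambda>y. G y (Z x) w) x u + G x (Z' u) w" for u
    using exp[OF linear_ddir_metric_left[OF x, of w u], of "Z x"] exp[OF lG[OF x], of "Z' u"]
    by (simp add: sum.distrib)
  ultimately have "((\<lambda>y. \<Sum>b\<in>Basis. (Z y \<bullet> b) * G y b w) has_derivative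
      (\<lambda>u. ddir (\<lambda>y. G y (Z x) w) x u + G x (Z' u) w)) (at x)" by simp
  then show ?thesis
    by (rule has_derivative_transform_within_open[OF _ metric_on_open x]) (rule exp[OF lG, symmetric])
qed

end

section \<open>Gradient and Hessian in coordinates\<close>

definition local_grad :: "('e::euclidean_space, 'e) metric \<Rightarrow> ('e \<Rightarrow> real) \<Rightarrow> 'e \<Rightarrow> 'e" where
  "local_grad G F x = raise_index (G x) (ddir F x)"

definition local_hessian ::
    "('e::euclidean_space, 'e) metric \<Rightarrow> ('e \<Rightarrow> real) \<Rightarrow> 'e \<Rightarrow> 'e \<Rightarrow> 'e \<Rightarrow> real" where
  "local_hessian G F x v w = ddir (\<lambda>y. ddir F y w) x v - ddir F x (christoffel G x v w)"

lemma linear_ddir_smooth: "smooth_on S F \<Longrightarrow> x \<in> S \<Longrightarrow> linear (ddir F x)"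
  using smooth_on_has_derivative has_derivative_linear by blast

context
  fixes S :: "'e::euclidean_space set" and G :: "('e, 'e) metric" and F :: "'e \<Rightarrow> real"
  assumes G: "metric_on S G" and F: "smooth_on S F"
begin

lemma metric_local_grad: "x \<in> S \<Longrightarrow> G x (local_grad G F x) w = ddir F x w"
  unfolding local_grad_def by (intro raise_index metric_on_inner_form[OF G] linear_ddir_smooth[OF F])

lemma local_grad_has_derivative:
  assumes "x \<in> S"
  shows "(local_grad G F has_derivative ddir (local_grad G F) x) (at x)"
proof -
  have "(\<lambda>y. ddir F y w) differentiable (at x)" for w
    using smooth_on_has_derivative[OF smooth_on_ddir[OF F] assms] by (auto simp: differentiable_def)
  then have "local_grad G F differentiable (at x)"
    unfolding local_grad_def
    by (intro raise_index_metric_differentiable[OF G] linear_ddir_smooth[OF F] assms) auto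
  then show ?thesis by (simp add: frechet_derivative_works)
qed

text \<open>The vector dual to \<open>H(u,\<cdot>)\<close> is \<open>\<nabla>\<^sub>u grad F\<close>.\<close>

lemma raise_index_local_hessian:
  assumes x: "x \<in> S"
  shows "raise_index (G x) (local_hessian G F x u) =
    ddir (local_grad G F) x u + christoffel G x u (local_grad G F x)"
proof (rule raise_index_unique[OF metric_on_inner_form[OF G x]])
  fix w
  \<comment> \<open>The identity \<open>dF(w) = G(grad F, w)\<close> is differentiated. Metric
    compatibility then removes the derivative of the metric, and its second term cancels the
    Christoffel term of the Hessian.\<close>
  have "ddir (\<lambda>y. ddir F y w) x =
      (\<lambda>u. ddir (\<lambda>y. G y (local_grad G F x) w) x u + G x (ddir (local_grad G F) x u) w)"
    by (rule ddir_transform[OF metric_on_open[OF G] x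
          metric_has_derivative_left[OF G x local_grad_has_derivative[OF x]]])
      (rule metric_local_grad)
  then have "ddir (\<lambda>y. ddir F y w) x u =
      ddir (\<lambda>y. G y (local_grad G F x) w) x u + G x (ddir (local_grad G F) x u) w" by simp
  then show "G x (ddir (local_grad G F) x u + christoffel G x u (local_grad G F x)) w =
      local_hessian G F x u w"
    using metric_compatible[OF G x, of "local_grad G F x" w u]
    by (simp add: local_hessian_def bilinear_ladd[OF metric_on_bilinear[OF G x]] metric_local_grad[OF x])
qed

end

subsection \<open>Ricci curvature of a warped product in coordinates\<close>

lemma has_derivative_compose_fst:
  "(F has_derivative F') (at (fst z)) \<Longrightarrow> ((\<lambda>z. F (fst z)) has_derivative (\<lambda>v. F' (fst v))) (at z)"
  using has_derivative_compose[OF has_derivative_fst[OF has_derivative_ident], of F F' z UNIV] by simp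

lemma has_derivative_compose_snd:
  "(F has_derivative F') (at (snd z)) \<Longrightarrow> ((\<lambda>z. F (snd z)) has_derivative (\<lambda>v. F' (snd v))) (at z)"
  using has_derivative_compose[OF has_derivative_snd[OF has_derivative_ident], of F F' z UNIV] by simp

lemma tr_prod:
  fixes L :: "'e::euclidean_space \<times> 'f::euclidean_space \<Rightarrow> 'e \<times> 'f"
  shows "tr L = tr (\<lambda>u. fst (L (u, 0))) + tr (\<lambda>u. snd (L (0, u)))"
proof -
  have "inj_on (\<lambda>u. (u::'e, 0::'f)) Basis" "inj_on (\<lambda>u. (0::'e, u::'f)) Basis"
    by (auto intro!: inj_onI)
  then show ?thesis
    unfolding tr_def Basis_prod_def
    by (subst sum.union_disjoint) (auto simp: sum.reindex inner_prod_def)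
qed

lemma tr_add: "tr (\<lambda>u. L u + L' u) = tr L + tr L'"
  by (simp add: tr_def inner_add_left sum.distrib)

lemma tr_scaleR: "tr (\<lambda>u. c *\<^sub>R L u) = c * tr L"
  by (simp add: tr_def sum_distrib_left)

lemma tr_ident: "tr (\<lambda>u::'e::euclidean_space. u) = real DIM('e)"
  by (simp add: tr_def)

lemma tr_rank_one:
  fixes v :: "'e::euclidean_space"
  assumes "linear \<phi>"
  shows "tr (\<lambda>u. \<phi> u *\<^sub>R v) = \<phi> v"
  using linear_sum[OF assms, of "\<lambda>b. (v \<bullet> b) *\<^sub>R b" Basis]
  by (simp add: tr_def euclidean_representation linear_scale[OF assms] mult.commute)

lemma inner_form_nonneg: "inner_form B \<Longrightarrow> B v v \<ge> 0"
  by (cases "v = 0") (auto simp: inner_form_def bilinear_lzero less_imp_le)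

text \<open>The form \<open>D\<close> is described only by its values on pairs, so that this serves
  both for the metric on the product manifold and for its coordinate expression.\<close>

lemma warped_inner_form:
  assumes B: "inner_form B" and B': "inner_form B'" and "c > 0"
    and eq: "\<And>v v' w w'. D (v, v') (w, w') = B v w + c * B' v' w'"
  shows "inner_form D"
proof -
  note b = B[unfolded inner_form_def, THEN conjunct1] B'[unfolded inner_form_def, THEN conjunct1]
  have "bilinear D"
    unfolding bilinear_def
    by (auto intro!: linearI simp: eq bilinear_ladd[OF b(1)] bilinear_ladd[OF b(2)]
        bilinear_radd[OF b(1)] bilinear_radd[OF b(2)] bilinear_lmul[OF b(1)] bilinear_lmul[OF b(2)]
        bilinear_rmul[OF b(1)] bilinear_rmul[OF b(2)] algebra_simps)
  moreover have "D v w = D w v" for v w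
    using B B' by (cases v; cases w) (simp add: eq inner_form_def)
  moreover have "D v v > 0" if "v \<noteq> 0" for v
  proof -
    obtain v1 v2 where v: "v = (v1, v2)" by (cases v)
    have "v1 \<noteq> 0 \<or> v2 \<noteq> 0" using that v by (auto simp: zero_prod_def)
    then show ?thesis
      using inner_form_nonneg[OF B, of v1] inner_form_nonneg[OF B', of v2] B B' \<open>c > 0\<close>
      by (auto simp: v eq inner_form_def intro: add_pos_nonneg add_nonneg_pos)
  qed
  ultimately show ?thesis by (simp add: inner_form_def)
qed

section \<open>Connection of a warped product in coordinates\<close>

context
  fixes S :: "'e::euclidean_space set" and T :: "'f::euclidean_space set"
    and g :: "('e, 'e) metric" and g' :: "('f, 'f) metric" and F :: "'e \<Rightarrow> real"
    and G :: "('e \<times> 'f, 'e \<times> 'f) metric"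
  assumes g: "metric_on S g" and g': "metric_on T g'"
    and F: "smooth_on S F" and F_pos: "\<And>x. x \<in> S \<Longrightarrow> F x > 0"
    and G_eq: "\<And>x y v v' w w'. x \<in> S \<Longrightarrow> y \<in> T \<Longrightarrow>
      G (x, y) (v, v') (w, w') = g x v w + (F x)\<^sup>2 * g' y v' w'"
begin

lemma open_warped_domain: "open (S \<times> T)"
  by (intro open_Times metric_on_open[OF g] metric_on_open[OF g'])

text \<open>\<open>G\<close> is prescribed only on \<open>S \<times> T\<close>, so smoothness is
  carried over from the explicit formula along this open set. Afterwards the Koszul formula applies
  to \<open>G\<close>.\<close>

lemma warped_metric_on: "metric_on (S \<times> T) G"
  unfolding metric_on_def
proof (intro conjI allI ballI)
  show "inner_form (G z)" if zST: "z \<in> S \<times> T" for z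
  proof -
    obtain x y where z: "z = (x, y)" "x \<in> S" "y \<in> T" using zST by auto
    show ?thesis
      unfolding z(1)
      by (rule warped_inner_form[where c = "(F x)\<^sup>2", OF metric_on_inner_form[OF g] metric_on_inner_form[OF g'] _ G_eq])
        (use z F_pos[of x] in auto)
  qed
  show "smooth_on (S \<times> T) (\<lambda>z. G z v w)" for v w
  proof (rule smooth_on_transform[OF open_warped_domain])
    show "smooth_on (S \<times> T) (\<lambda>z. g (fst z) (fst v) (fst w)
        + (F (fst z) * F (fst z)) * g' (snd z) (snd v) (snd w))"
      by (intro smooth_on_add smooth_on_mult smooth_on_compose_fst smooth_on_compose_snd open_warped_domain
          metric_on_smooth[OF g] metric_on_smooth[OF g'] F metric_on_open[OF g] metric_on_open[OF g'])
    show "g (fst z) (fst v) (fst w) + (F (fst z) * F (fst z)) * g' (snd z) (snd v) (snd w) = G z v w"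
      if "z \<in> S \<times> T" for z
      using that by (cases z; cases v; cases w) (auto simp: G_eq power2_eq_square)
  qed
qed (rule open_warped_domain)

context
  fixes x y
  assumes x: "x \<in> S" and y: "y \<in> T"
begin

lemma ddir_warped_metric:
  "ddir (\<lambda>z. G z (v, v') (w, w')) (x, y) (u, u') =
    ddir (\<lambda>x. g x v w) x u + 2 * F x * ddir F x u * g' y v' w'
    + (F x)\<^sup>2 * ddir (\<lambda>y. g' y v' w') y u'"
proof -
  note d = has_derivative_compose_fst[of _ _ "(x, y)", simplified] has_derivative_compose_snd[of _ _ "(x, y)", simplified]
  note d' = d(1)[OF metric_on_has_derivative[OF g x]] d(2)[OF metric_on_has_derivative[OF g' y]]
    d(1)[OF smooth_on_has_derivative[OF F x]]
  have D: "((\<lambda>z. g (fst z) v w + F (fst z) * F (fst z) * g' (snd z) v' w') has_derivative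
      (\<lambda>u. ddir (\<lambda>x. g x v w) x (fst u) + 2 * F x * ddir F x (fst u) * g' y v' w'
        + F x * F x * ddir (\<lambda>y. g' y v' w') y (snd u))) (at (x, y))"
    by (rule has_derivative_eq_rhs[OF has_derivative_add[OF d'(1)
            has_derivative_mult[OF has_derivative_mult[OF d'(3) d'(3)] d'(2)]]])
      (simp add: fun_eq_iff algebra_simps)
  show ?thesis
    by (subst ddir_transform[OF open_warped_domain _ D]) (auto simp: x y G_eq power2_eq_square)
qed

text \<open>Both sides are paired with \<open>(w, w')\<close>. The term with \<open>dF(w)\<close> in
  the Koszul formula becomes a multiple of the gradient, and in the fibre slot the weight
  \<open>(F x)\<^sup>2\<close> of the metric turns the terms with \<open>F dF\<close> into
  \<open>dF / F\<close>.\<close>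

lemma warped_christoffel:
  "christoffel G (x, y) (u, u') (v, v') =
    (christoffel g x u v - (F x * g' y u' v') *\<^sub>R local_grad g F x,
     christoffel g' y u' v' + (ddir F x u / F x) *\<^sub>R v' + (ddir F x v / F x) *\<^sub>R u')"
    (is "_ = (?a, ?b)")
proof (rule inner_form_eqI[OF metric_on_inner_form[OF warped_metric_on]])
  show "(x, y) \<in> S \<times> T" using x y by simp
  fix W :: "'e \<times> 'f"
  obtain w w' where W: "W = (w, w')" by (cases W)
  note b = metric_on_bilinear[OF g x] metric_on_bilinear[OF g' y]
  have "G (x, y) (?a, ?b) (w, w') = g x (christoffel g x u v) w - F x * g' y u' v' * ddir F x w
     + (F x)\<^sup>2 * (g' y (christoffel g' y u' v') w'
         + ddir F x u / F x * g' y v' w' + ddir F x v / F x * g' y u' w')"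
    by (simp add: G_eq x y bilinear_lsub[OF b(1)] bilinear_lmul[OF b(1)] bilinear_ladd[OF b(2)]
      bilinear_lmul[OF b(2)] metric_local_grad[OF g F x])
  also have "\<dots> = G (x, y) (christoffel G (x, y) (u, u') (v, v')) (w, w')"
    using F_pos[OF x] x y
    by (simp add: koszul[OF g x] koszul[OF g' y] koszul[OF warped_metric_on] ddir_warped_metric
      field_simps power2_eq_square)
  finally show "G (x, y) (christoffel G (x, y) (u, u') (v, v')) W = G (x, y) (?a, ?b) W"
    by (simp add: W)
qed

text \<open>Simplification rules for lifts, which have a zero component.\<close>

lemma tensors_zero:
  "christoffel g x 0 v = 0" "christoffel g x v 0 = 0"
  "christoffel g' y 0 v' = 0" "christoffel g' y v' 0 = 0"
  "g x 0 v = 0" "g' y 0 v' = 0" "g x v 0 = 0" "g' y v' 0 = 0" "ddir F x 0 = 0"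
  using bilinear_lzero[OF bilinear_christoffel[OF g x]] bilinear_rzero[OF bilinear_christoffel[OF g x]]
    bilinear_lzero[OF bilinear_christoffel[OF g' y]] bilinear_rzero[OF bilinear_christoffel[OF g' y]]
    bilinear_lzero[OF metric_on_bilinear[OF g x]] bilinear_lzero[OF metric_on_bilinear[OF g' y]]
    bilinear_rzero[OF metric_on_bilinear[OF g x]] bilinear_rzero[OF metric_on_bilinear[OF g' y]]
    linear_0[OF linear_ddir_smooth[OF F x]]
  by simp_all

lemma christoffel_has_derivative:
  "((\<lambda>x. christoffel g x u v) has_derivative ddir (\<lambda>x. christoffel g x u v) x) (at x)"
  "((\<lambda>y. christoffel g' y u' v') has_derivative ddir (\<lambda>y. christoffel g' y u' v') y) (at y)"
  using christoffel_differentiable[OF g x] christoffel_differentiable[OF g' y]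
  by (simp_all add: frechet_derivative_works)

end

section \<open>Curvature and Ricci tensor of a warped product in coordinates\<close>

text \<open>In the fibre slot, differentiating \<open>dF(w) / F\<close> along \<open>v\<close>
  produces a quadratic term in \<open>dF\<close>. It cancels against the product of Christoffel
  terms, and what remains is the Hessian divided by \<open>F\<close>.\<close>

lemma warped_curvature_base:
  assumes x: "x \<in> S" and y: "y \<in> T"
  shows "local_curvature G (x, y) (u, u') (v, 0) (w, 0) =
    (local_curvature g x u v w, - (local_hessian g F x v w / F x) *\<^sub>R u')"
proof -
  note [simp] = tensors_zero[OF x y] x y
  note d = has_derivative_compose_fst[of _ _ "(x, y)", simplified]
  have 1: "ddir (\<lambda>z. christoffel G z (v, 0) (w, 0)) (x, y) (u, u')
      = (ddir (\<lambda>x. christoffel g x v w) x u, 0)"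
    by (subst ddir_transform[OF open_warped_domain _ has_derivative_Pair[OF d[OF christoffel_has_derivative(1)[OF x y, of v w]]
            has_derivative_const[of 0]]])
      (auto simp: warped_christoffel tensors_zero)
  have q: "((\<lambda>x. (ddir F x w / F x) *\<^sub>R u') has_derivative
     (\<lambda>h. ((- ddir F x w * (inverse (F x) * ddir F x h * inverse (F x)) + ddir (\<lambda>x. ddir F x w) x h / F x)) *\<^sub>R u')) (at x)"
    using F_pos[OF x]
    by (intro has_derivative_scaleR_left has_derivative_divide
        smooth_on_has_derivative[OF F x] smooth_on_has_derivative[OF smooth_on_ddir[OF F] x]) auto
  have 2: "ddir (\<lambda>z. christoffel G z (u, u') (w, 0)) (x, y) (v, 0)
      = (ddir (\<lambda>x. christoffel g x u w) x v,
         (ddir (\<lambda>x. ddir F x w) x v / F x - ddir F x w * ddir F x v / (F x)\<^sup>2) *\<^sub>R u')"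
    by (subst ddir_transform[OF open_warped_domain _ has_derivative_Pair[OF d[OF christoffel_has_derivative(1)[OF x y, of u w]] d[OF q]]])
      (auto simp: warped_christoffel tensors_zero divide_inverse power2_eq_square algebra_simps)
  show ?thesis
    using F_pos[OF x]
    by (simp add: local_curvature_def 1 2 warped_christoffel local_hessian_def scaleR_left.diff[symmetric]
        scaleR_left.add[symmetric] flip: scaleR_minus_left)
      (simp add: field_simps power2_eq_square)
qed

text \<open>\<open>N\<close> is the squared norm of the gradient. In the base component the terms
  along the gradient cancel, leaving \<open>\<nabla>_u grad F\<close>, which is the raised Hessian.
  The fibre component is arranged as a curvature, a multiple of the identity and a rank-one map,
  ready for taking traces.\<close>

lemma warped_curvature_fiber:
  assumes x: "x \<in> S" and y: "y \<in> T"
  defines "N \<equiv> ddir F x (local_grad g F x)"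
  shows "fst (local_curvature G (x, y) (u, 0) (0, v) (0, w)) =
      - (F x * g' y v w) *\<^sub>R raise_index (g x) (local_hessian g F x u)" (is ?base)
    and "snd (local_curvature G (x, y) (0, u') (0, v) (0, w)) =
      local_curvature g' y u' v w + (- (N * g' y v w)) *\<^sub>R u' + N *\<^sub>R (g' y u' w *\<^sub>R v)" (is ?fiber)
proof -
  note [simp] = tensors_zero[OF x y] x y
  let ?Z = "local_grad g F"
  note d = has_derivative_compose_fst[of _ _ "(x, y)", simplified]
  note d' = has_derivative_compose_snd[of _ _ "(x, y)", simplified]
  note dF = smooth_on_has_derivative[OF F x]
  note dZ = local_grad_has_derivative[OF g F x]
  have D: "((\<lambda>z. (- ((F (fst z) * g' (snd z) v w) *\<^sub>R ?Z (fst z)), christoffel g' (snd z) v w)) has_derivative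
      (\<lambda>h. (- ((F x * g' y v w) *\<^sub>R ddir ?Z x (fst h)
         + (F x * ddir (\<lambda>y. g' y v w) y (snd h) + ddir F x (fst h) * g' y v w) *\<^sub>R ?Z x),
        ddir (\<lambda>y. christoffel g' y v w) y (snd h)))) (at (x, y))" for v w
    by (rule has_derivative_eq_rhs[OF has_derivative_Pair[OF has_derivative_minus[OF has_derivative_scaleR[OF
             has_derivative_mult[OF d[OF dF] d'[OF metric_on_has_derivative[OF g' y]]] d[OF dZ]]]
             d'[OF christoffel_has_derivative(2)[OF x y]]]])
      (simp add: fun_eq_iff)
  \<comment> \<open>Stated for all vectors because the fibre component also needs it with
    \<open>u'\<close> in place of \<open>v\<close>.\<close>
  have 1: "ddir (\<lambda>z. christoffel G z (0, v) (0, w)) (x, y) (h, h') =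
       (- ((F x * g' y v w) *\<^sub>R ddir ?Z x h
         + (F x * ddir (\<lambda>y. g' y v w) y h' + ddir F x h * g' y v w) *\<^sub>R ?Z x),
        ddir (\<lambda>y. christoffel g' y v w) y h')" for v w h h'
    by (subst ddir_transform[OF open_warped_domain _ D]) (auto simp: warped_christoffel tensors_zero)
  have q: "((\<lambda>x. (ddir F x u / F x) *\<^sub>R w) has_derivative
     (\<lambda>h. ((- ddir F x u * (inverse (F x) * ddir F x h * inverse (F x)) + ddir (\<lambda>x. ddir F x u) x h / F x)) *\<^sub>R w)) (at x)"
    using F_pos[OF x]
    by (intro has_derivative_scaleR_left has_derivative_divide
        smooth_on_has_derivative[OF F x] smooth_on_has_derivative[OF smooth_on_ddir[OF F] x]) auto
  \<comment> \<open>This Christoffel term is \<open>(0, (dF(u) / F) w)\<close>, which depends on the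
    base point alone, so it is constant along the fibre.\<close>
  have 2: "ddir (\<lambda>z. christoffel G z (u, 0) (0, w)) (x, y) (0, v) = (0, 0)"
    by (subst ddir_transform[OF open_warped_domain _ has_derivative_Pair[OF has_derivative_const[of 0] d[OF q]]])
      (auto simp: warped_christoffel tensors_zero zero_prod_def linear_0[OF linear_ddir_smooth[OF smooth_on_ddir[OF F] x]])
  note lb = linear_christoffel_right[OF g x]
  note lb' = linear_christoffel_right[OF g' y]
  show ?base
    using F_pos[OF x]
    by (simp add: local_curvature_def 1 2 warped_christoffel raise_index_local_hessian[OF g F x]
        linear_scale[OF lb] linear_neg[OF lb] linear_scale[OF lb'] linear_0[OF linear_ddir_metric[OF g' y]]
        bilinear_rmul[OF metric_on_bilinear[OF g' y]] scaleR_right_distrib scaleR_add_left)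
  show ?fiber
    using F_pos[OF x]
    by (simp add: local_curvature_def 1 warped_christoffel N_def linear_neg[OF linear_ddir_smooth[OF F x]]
        linear_scale[OF linear_ddir_smooth[OF F x]] mult.commute)
qed

lemma local_ricci_warped_base:
  assumes x: "x \<in> S" and y: "y \<in> T"
  shows "local_ricci G (x, y) (v, 0) (w, 0) =
    local_ricci g x v w - real DIM('f) / F x * local_hessian g F x v w"
  by (simp add: local_ricci_def tr_prod warped_curvature_base[OF assms] tr_scaleR tr_ident
      flip: scaleR_minus_left)

text \<open>In the fibre block the multiple of the identity has trace
  \<open>- DIM('f) * N * g' y v w\<close>, while the rank-one map contributes
  \<open>+ N * g' y v w\<close>. This accounts for \<open>DIM('f) - 1\<close>.\<close>

lemma local_ricci_warped_fiber:
  assumes x: "x \<in> S" and y: "y \<in> T"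
  shows "local_ricci G (x, y) (0, v) (0, w) = local_ricci g' y v w
    - (F x * tr (\<lambda>u. raise_index (g x) (local_hessian g F x u))
       + (real DIM('f) - 1) * ddir F x (local_grad g F x)) * g' y v w"
proof -
  have l: "linear (\<lambda>u. g' y u w)"
    using metric_on_bilinear[OF g' y] by (simp add: bilinear_def)
  show ?thesis
    unfolding local_ricci_def tr_prod warped_curvature_fiber[OF assms] tr_add tr_scaleR tr_ident tr_rank_one[OF l]
    by (simp add: algebra_simps)
qed

end

subsection \<open>Manifolds and their products\<close>

context
  fixes M :: "('a::{t2_space,second_countable_topology}, 'e::euclidean_space) manifold"
  assumes M: "smooth_manifold M"
begin

lemma chart_homeomorphism:
  "c \<in> atlas M \<Longrightarrow> homeomorphism (chart_dom c) (chart_img c) (chart_map c) (chart_inv c)"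
  using M by (simp add: smooth_manifold_def)

lemma open_chart_dom: "c \<in> atlas M \<Longrightarrow> open (chart_dom c)"
  using M by (simp add: smooth_manifold_def)

lemma open_chart_img: "c \<in> atlas M \<Longrightarrow> open (chart_img c)"
  using M by (simp add: smooth_manifold_def)

lemma chart_at_in_atlas: "chart_at M p \<in> atlas M"
  using M by (simp add: smooth_manifold_def)

lemma in_chart_at_dom: "p \<in> chart_dom (chart_at M p)"
  using M by (simp add: smooth_manifold_def)

lemma chart_inv_map: "c \<in> atlas M \<Longrightarrow> p \<in> chart_dom c \<Longrightarrow> chart_inv c (chart_map c p) = p"
  using chart_homeomorphism by (simp add: homeomorphism_def)

lemma chart_map_inv: "c \<in> atlas M \<Longrightarrow> x \<in> chart_img c \<Longrightarrow> chart_map c (chart_inv c x) = x"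
  using chart_homeomorphism by (simp add: homeomorphism_def)

lemma chart_inv_in_dom: "c \<in> atlas M \<Longrightarrow> x \<in> chart_img c \<Longrightarrow> chart_inv c x \<in> chart_dom c"
  using chart_homeomorphism unfolding homeomorphism_def by blast

lemma inj_on_chart_map: "c \<in> atlas M \<Longrightarrow> inj_on (chart_map c) (chart_dom c)"
  by (metis chart_inv_map inj_onI)

text \<open>A homeomorphism onto an open set carries the open overlap to an open set, which the
  rules for smooth functions require.\<close>

lemma open_chart_overlap:
  assumes "c \<in> atlas M" "d \<in> atlas M"
  shows "open (chart_map c ` (chart_dom c \<inter> chart_dom d))"
proof -
  have "openin (top_of_set (chart_dom c)) (chart_dom c \<inter> chart_dom d)"
    using assms open_chart_dom by (simp add: openin_open_Int)
  then have "openin (top_of_set (chart_img c)) (chart_map c ` (chart_dom c \<inter> chart_dom d))"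
    using homeomorphism_imp_open_map[OF chart_homeomorphism[OF assms(1)]] by blast
  then show ?thesis
    using open_chart_img[OF assms(1)] openin_open_trans by blast
qed

lemma smooth_on_transition:
  "c \<in> atlas M \<Longrightarrow> d \<in> atlas M \<Longrightarrow>
    smooth_on (chart_map c ` (chart_dom c \<inter> chart_dom d)) (chart_map d \<circ> chart_inv c)"
  using M by (simp add: smooth_manifold_def)

lemma transition_has_derivative:
  assumes "c \<in> atlas M" "d \<in> atlas M" "p \<in> chart_dom c" "p \<in> chart_dom d"
  shows "((chart_map d \<circ> chart_inv c) has_derivative tangent_change c d p) (at (chart_map c p))"
  using smooth_on_has_derivative[OF smooth_on_transition[OF assms(1,2)], of "chart_map c p"] assms(3,4)
  by (auto simp: tangent_change_def[abs_def])

lemma linear_tangent_change: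
  assumes "c \<in> atlas M" "d \<in> atlas M" "p \<in> chart_dom c" "p \<in> chart_dom d"
  shows "linear (tangent_change c d p)"
  using transition_has_derivative[OF assms] has_derivative_linear by blast

lemma tangent_change_self:
  assumes "c \<in> atlas M" "p \<in> chart_dom c"
  shows "tangent_change c c p v = v"
proof -
  have "ddir (chart_map c \<circ> chart_inv c) (chart_map c p) = (\<lambda>v. v)"
    using assms chart_map_inv
    by (intro ddir_transform[OF open_chart_img _ has_derivative_ident]) (auto simp: chart_img_def)
  then show ?thesis by (simp add: tangent_change_def)
qed

text \<open>The chain rule is applied to the two mutually inverse transition maps. The resulting
  injectivity keeps the metric positive definite in every chart.\<close>

lemma tangent_change_inverse:
  assumes cd: "c \<in> atlas M" "d \<in> atlas M" and p: "p \<in> chart_dom c" "p \<in> chart_dom d"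
  shows "tangent_change d c p (tangent_change c d p v) = v"
proof -
  have "((chart_map d \<circ> chart_inv c) (chart_map c p)) = chart_map d p"
    using chart_inv_map[OF cd(1) p(1)] by simp
  then have "(((chart_map c \<circ> chart_inv d) \<circ> (chart_map d \<circ> chart_inv c)) has_derivative
      (tangent_change d c p \<circ> tangent_change c d p)) (at (chart_map c p))"
    using diff_chain_at[OF transition_has_derivative[OF cd p], of "chart_map c \<circ> chart_inv d"]
      transition_has_derivative[OF cd(2,1) p(2,1)] by simp
  then have "ddir (\<lambda>x. x) (chart_map c p) = tangent_change d c p \<circ> tangent_change c d p"
    by (rule ddir_transform[OF open_chart_overlap[OF cd], rotated])
      (use p cd in \<open>auto simp: chart_inv_map\<close>)
  then show ?thesis by (metis comp_apply frechet_derivative_ident)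
qed

end

section \<open>Riemannian metrics read in charts\<close>

lemma riemannian_manifold_iff:
  "riemannian_manifold M g \<longleftrightarrow> smooth_manifold M \<and> (\<forall>p. inner_form (g p)) \<and>
     (\<forall>c\<in>atlas M. \<forall>v w. smooth_on (chart_img c) (\<lambda>x. local_metric M g c x v w))"
  unfolding riemannian_manifold_def inner_form_def by auto

lemma inner_form_pullback:
  assumes "inner_form B" "linear L" "\<And>v. L v = 0 \<Longrightarrow> v = 0"
  shows "inner_form (\<lambda>v w. B (L v) (L w))"
proof -
  have "B (L v) (L v) > 0" if "v \<noteq> 0" for v
    using assms(1,3) that unfolding inner_form_def by metis
  then show ?thesis
    using assms(1,2) by (auto simp: inner_form_def bilinear_def linear_iff)
qed

lemma metric_on_local_metric:
  assumes R: "riemannian_manifold M g" and c: "c \<in> atlas M"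
  shows "metric_on (chart_img c) (local_metric M g c)"
proof -
  have M: "smooth_manifold M" and g: "\<And>p. inner_form (g p)"
    using R by (auto simp: riemannian_manifold_iff)
  have "inner_form (local_metric M g c x)" if "x \<in> chart_img c" for x
  proof -
    let ?p = "chart_inv c x"
    note A = c chart_at_in_atlas[OF M, of ?p] chart_inv_in_dom[OF M c that] in_chart_at_dom[OF M, of ?p]
    have inj: "v = 0" if "tangent_change c (chart_at M ?p) ?p v = 0" for v
      using tangent_change_inverse[OF M A, of v] that linear_0[OF linear_tangent_change[OF M A(2,1,4,3)]]
      by simp
    show ?thesis
      unfolding local_metric_def[abs_def] Let_def
      by (rule inner_form_pullback[OF g linear_tangent_change[OF M A] inj])
  qed
  then show ?thesis
    using R c open_chart_img[OF M c] by (simp add: metric_on_def riemannian_manifold_iff)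
qed

text \<open>A change from a chart to itself is the identity. Hence tensors formed with
  \<open>g p\<close> agree with those computed in the preferred chart at \<open>p\<close>.\<close>

lemma local_metric_chart_at:
  assumes M: "smooth_manifold M"
  shows "local_metric M g (chart_at M p) (chart_map (chart_at M p) p) = g p"
  by (simp add: local_metric_def chart_inv_map[OF M chart_at_in_atlas[OF M] in_chart_at_dom[OF M]]
      tangent_change_self[OF M chart_at_in_atlas[OF M] in_chart_at_dom[OF M]] fun_eq_iff)

section \<open>Product charts, product manifolds and lifts of vector fields\<close>

lemma continuous_on_map_prod:
  assumes "continuous_on S F" "continuous_on T H"
  shows "continuous_on (S \<times> T) (map_prod F H)"
proof -
  have "continuous_on (S \<times> T) (\<lambda>z. (F (fst z), H (snd z)))"
    by (intro continuous_on_Pair continuous_on_compose2[OF assms(1)] continuous_on_compose2[OF assms(2)]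
        continuous_on_fst continuous_on_snd continuous_on_id) auto
  then show ?thesis by (simp add: map_prod_def case_prod_beta)
qed

lemma chart_dom_prod [simp]: "chart_dom (prod_chart c d) = chart_dom c \<times> chart_dom d"
  by (simp add: prod_chart_def)

lemma chart_map_prod [simp]: "chart_map (prod_chart c d) = map_prod (chart_map c) (chart_map d)"
  by (simp add: prod_chart_def)

lemma chart_img_prod [simp]: "chart_img (prod_chart c d) = chart_img c \<times> chart_img d"
  by (auto simp: chart_img_def)

lemma atlas_prod: "atlas (prod_manifold M N) = {prod_chart c d | c d. c \<in> atlas M \<and> d \<in> atlas N}"
  by (simp add: prod_manifold_def)

lemma chart_at_prod [simp]:
  "chart_at (prod_manifold M N) (p, q) = prod_chart (chart_at M p) (chart_at N q)"
  by (simp add: prod_manifold_def)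

context
  fixes M :: "('a::{t2_space,second_countable_topology}, 'e::euclidean_space) manifold"
    and N :: "('b::{t2_space,second_countable_topology}, 'f::euclidean_space) manifold"
  assumes M: "smooth_manifold M" and N: "smooth_manifold N"
begin

text \<open>\<open>chart_inv\<close> is a choice of preimage, so injectivity of the product map on
  its domain is what identifies it with the pair of inverses on the image.\<close>

lemma chart_inv_prod:
  assumes "c \<in> atlas M" "d \<in> atlas N" "x \<in> chart_img c" "y \<in> chart_img d"
  shows "chart_inv (prod_chart c d) (x, y) = (chart_inv c x, chart_inv d y)"
proof -
  have "inj_on (map_prod (chart_map c) (chart_map d)) (chart_dom c \<times> chart_dom d)"
    by (intro map_prod_inj_on inj_on_chart_map[OF M] inj_on_chart_map[OF N] assms)
  then show ?thesis
    unfolding chart_inv_def[of "prod_chart c d"]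
    using assms chart_inv_in_dom[OF M] chart_inv_in_dom[OF N] chart_map_inv[OF M] chart_map_inv[OF N]
    by (intro inv_into_f_eq) auto
qed

lemma transition_prod:
  assumes "c \<in> atlas M" "d \<in> atlas N"
    and "z \<in> chart_map c ` (chart_dom c \<inter> chart_dom c') \<times> chart_map d ` (chart_dom d \<inter> chart_dom d')"
  shows "map_prod (chart_map c' \<circ> chart_inv c) (chart_map d' \<circ> chart_inv d) z =
    (chart_map (prod_chart c' d') \<circ> chart_inv (prod_chart c d)) z"
  using assms by (cases z) (auto simp: chart_inv_prod chart_img_def)

lemma smooth_manifold_prod: "smooth_manifold (prod_manifold M N)"
  unfolding smooth_manifold_def atlas_prod
proof (intro conjI ballI allI; (elim CollectE exE conjE)?)
  fix k c d assume k: "k = prod_chart c d" and cd: "c \<in> atlas M" "d \<in> atlas N"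
  show "open (chart_dom k)"
    using k cd open_chart_dom[OF M] open_chart_dom[OF N] by (simp add: open_Times)
  show "open (chart_img k)"
    using k cd open_chart_img[OF M] open_chart_img[OF N] by (simp add: open_Times)
  note h = chart_homeomorphism[OF M cd(1)] chart_homeomorphism[OF N cd(2)]
  have "homeomorphism (chart_dom c \<times> chart_dom d) (chart_img c \<times> chart_img d)
      (map_prod (chart_map c) (chart_map d)) (map_prod (chart_inv c) (chart_inv d))"
    using h by (intro homeomorphismI continuous_on_map_prod) (auto simp: homeomorphism_def)
  then show "homeomorphism (chart_dom k) (chart_img k) (chart_map k) (chart_inv k)"
    by (rule homeomorphism_cong) (use k cd in \<open>auto simp: chart_inv_prod\<close>)
next
  fix k k' c d c' d'
  assume k: "k = prod_chart c d" "k' = prod_chart c' d'"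
    and cd: "c \<in> atlas M" "d \<in> atlas N" "c' \<in> atlas M" "d' \<in> atlas N"
  let ?S = "chart_map c ` (chart_dom c \<inter> chart_dom c')"
  let ?T = "chart_map d ` (chart_dom d \<inter> chart_dom d')"
  note op = open_chart_overlap[OF M cd(1,3)] open_chart_overlap[OF N cd(2,4)]
  have "smooth_on (?S \<times> ?T) (chart_map k' \<circ> chart_inv k)"
    unfolding k
    by (rule smooth_on_transform[OF open_Times[OF op] smooth_on_map_prod[OF op
            smooth_on_transition[OF M cd(1,3)] smooth_on_transition[OF N cd(2,4)]] transition_prod[OF cd(1,2)]])
  moreover have "chart_map k ` (chart_dom k \<inter> chart_dom k') = ?S \<times> ?T"
    unfolding k by auto
  ultimately show "smooth_on (chart_map k ` (chart_dom k \<inter> chart_dom k')) (chart_map k' \<circ> chart_inv k)"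
    by simp
next
  fix z show "chart_at (prod_manifold M N) z \<in> {prod_chart c d | c d. c \<in> atlas M \<and> d \<in> atlas N}"
    using chart_at_in_atlas[OF M] chart_at_in_atlas[OF N] by (cases z) auto
  show "z \<in> chart_dom (chart_at (prod_manifold M N) z)"
    using in_chart_at_dom[OF M] in_chart_at_dom[OF N] by (cases z) auto
qed

lemma tangent_change_prod:
  assumes cd: "c \<in> atlas M" "d \<in> atlas N" "c' \<in> atlas M" "d' \<in> atlas N"
    and p: "p \<in> chart_dom c" "p \<in> chart_dom c'" and q: "q \<in> chart_dom d" "q \<in> chart_dom d'"
  shows "tangent_change (prod_chart c d) (prod_chart c' d') (p, q) (v, w) =
    (tangent_change c c' p v, tangent_change d d' q w)"
proof -
  let ?x = "(chart_map c p, chart_map d q)"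
  note D = has_derivative_Pair[OF
      has_derivative_compose_fst[of _ _ ?x, simplified, OF transition_has_derivative[OF M cd(1,3) p]]
      has_derivative_compose_snd[of _ _ ?x, simplified, OF transition_has_derivative[OF N cd(2,4) q]]]
  have "ddir (chart_map (prod_chart c' d') \<circ> chart_inv (prod_chart c d)) ?x =
      (\<lambda>v. (tangent_change c c' p (fst v), tangent_change d d' q (snd v)))"
  proof (rule ddir_transform[OF open_Times[OF open_chart_overlap[OF M cd(1,3)]
        open_chart_overlap[OF N cd(2,4)]] _ D])
    fix z assume "z \<in> chart_map c ` (chart_dom c \<inter> chart_dom c') \<times> chart_map d ` (chart_dom d \<inter> chart_dom d')"
    from transition_prod[OF cd(1,2) this]
    show "((chart_map c' \<circ> chart_inv c) (fst z), (chart_map d' \<circ> chart_inv d) (snd z)) =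
        (chart_map (prod_chart c' d') \<circ> chart_inv (prod_chart c d)) z"
      by (simp add: map_prod_def case_prod_beta)
  qed (use p q in auto)
  then show ?thesis by (simp add: tangent_change_def)
qed

text \<open>This is the form of the metric from which the coordinate computation starts.\<close>

lemma local_metric_warped:
  assumes cd: "c \<in> atlas M" "d \<in> atlas N" and xy: "x \<in> chart_img c" "y \<in> chart_img d"
  shows "local_metric (prod_manifold M N) (warped_metric g f g') (prod_chart c d) (x, y) (v, v') (w, w') =
    local_metric M g c x v w + ((f \<circ> chart_inv c) x)\<^sup>2 * local_metric N g' d y v' w'"
  using cd xy
  by (simp add: local_metric_def chart_inv_prod tangent_change_prod warped_metric_def Let_def
      chart_at_in_atlas[OF M] chart_at_in_atlas[OF N] in_chart_at_dom[OF M] in_chart_at_dom[OF N]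
      chart_inv_in_dom[OF M] chart_inv_in_dom[OF N])

text \<open>In a product chart the lift is the coordinate expression of \<open>X\<close> composed
  with the projection and a linear embedding. Its zero component stays zero because tangent changes
  are linear.\<close>

lemma vector_field_lift_fst:
  assumes X: "vector_field M X"
  shows "vector_field (prod_manifold M N) (\<lambda>p. (X (fst p), 0))"
  unfolding vector_field_def atlas_prod
proof (intro ballI, elim CollectE exE conjE)
  fix k c d assume k: "k = prod_chart c d" and cd: "c \<in> atlas M" "d \<in> atlas N"
  let ?Y = "\<lambda>x. let p = chart_inv c x in tangent_change (chart_at M p) c p (X p)"
  note op = open_chart_img[OF M cd(1)] open_chart_img[OF N cd(2)]
  have bl: "bounded_linear (\<lambda>u::'e. (u, 0::'f))"
    by (intro bounded_linear_Pair bounded_linear_ident bounded_linear_zero)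
  have "smooth_on (chart_img c \<times> chart_img d) (\<lambda>z. (?Y (fst z), 0::'f))"
    using X cd
    by (intro smooth_on_linear[OF open_Times[OF op] bl] smooth_on_compose_fst[OF op]) (simp add: vector_field_def)
  then have "smooth_on (chart_img c \<times> chart_img d) (\<lambda>z. let p = chart_inv k z in
      tangent_change (chart_at (prod_manifold M N) p) k p (X (fst p), 0))"
  proof (rule smooth_on_transform[OF open_Times[OF op]])
    fix z assume "z \<in> chart_img c \<times> chart_img d"
    then obtain x y where z: "z = (x, y)" "x \<in> chart_img c" "y \<in> chart_img d" by auto
    have "tangent_change (chart_at N q) d q 0 = 0" if "q \<in> chart_dom d" for q
      by (rule linear_0[OF linear_tangent_change[OF N chart_at_in_atlas[OF N] cd(2) in_chart_at_dom[OF N] that]])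
    then show "(?Y (fst z), 0::'f) = (let p = chart_inv k z in
      tangent_change (chart_at (prod_manifold M N) p) k p (X (fst p), 0))"
      using z cd
      by (simp add: k chart_inv_prod tangent_change_prod Let_def
          chart_at_in_atlas[OF M] chart_at_in_atlas[OF N] in_chart_at_dom[OF M] in_chart_at_dom[OF N]
          chart_inv_in_dom[OF M] chart_inv_in_dom[OF N])
  qed
  then show "smooth_on (chart_img k) (\<lambda>z. let p = chart_inv k z in
      tangent_change (chart_at (prod_manifold M N) p) k p (X (fst p), 0))"
    by (simp add: k)
qed

lemma vector_field_lift_snd:
  assumes X: "vector_field N X"
  shows "vector_field (prod_manifold M N) (\<lambda>p. (0, X (snd p)))"
  unfolding vector_field_def atlas_prod
proof (intro ballI, elim CollectE exE conjE)
  fix k c d assume k: "k = prod_chart c d" and cd: "c \<in> atlas M" "d \<in> atlas N"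
  let ?Y = "\<lambda>x. let p = chart_inv d x in tangent_change (chart_at N p) d p (X p)"
  note op = open_chart_img[OF M cd(1)] open_chart_img[OF N cd(2)]
  have bl: "bounded_linear (\<lambda>u::'f. (0::'e, u))"
    by (intro bounded_linear_Pair bounded_linear_ident bounded_linear_zero)
  have "smooth_on (chart_img c \<times> chart_img d) (\<lambda>z. (0::'e, ?Y (snd z)))"
    using X cd
    by (intro smooth_on_linear[OF open_Times[OF op] bl] smooth_on_compose_snd[OF op]) (simp add: vector_field_def)
  then have "smooth_on (chart_img c \<times> chart_img d) (\<lambda>z. let p = chart_inv k z in
      tangent_change (chart_at (prod_manifold M N) p) k p (0, X (snd p)))"
  proof (rule smooth_on_transform[OF open_Times[OF op]])
    fix z assume "z \<in> chart_img c \<times> chart_img d"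
    then obtain x y where z: "z = (x, y)" "x \<in> chart_img c" "y \<in> chart_img d" by auto
    have "tangent_change (chart_at M p) c p 0 = 0" if "p \<in> chart_dom c" for p
      by (rule linear_0[OF linear_tangent_change[OF M chart_at_in_atlas[OF M] cd(1) in_chart_at_dom[OF M] that]])
    then show "(0::'e, ?Y (snd z)) = (let p = chart_inv k z in
      tangent_change (chart_at (prod_manifold M N) p) k p (0, X (snd p)))"
      using z cd
      by (simp add: k chart_inv_prod tangent_change_prod Let_def
          chart_at_in_atlas[OF M] chart_at_in_atlas[OF N] in_chart_at_dom[OF M] in_chart_at_dom[OF N]
          chart_inv_in_dom[OF M] chart_inv_in_dom[OF N])
  qed
  then show "smooth_on (chart_img k) (\<lambda>z. let p = chart_inv k z in
      tangent_change (chart_at (prod_manifold M N) p) k p (0, X (snd p)))"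
    by (simp add: k)
qed

end

subsection \<open>Ricci curvature of a warped product\<close>

context
  fixes M :: "('a::{t2_space,second_countable_topology}, 'e::euclidean_space) manifold"
    and N :: "('b::{t2_space,second_countable_topology}, 'f::euclidean_space) manifold"
    and g :: "('a, 'e) metric" and g' :: "('b, 'f) metric" and f :: "'a \<Rightarrow> real"
  assumes Mg: "riemannian_manifold M g" and Ng: "riemannian_manifold N g'"
    and f: "smooth_function M f" and f_pos: "\<And>p. f p > 0"
begin

lemma smooth_factors: "smooth_manifold M" "smooth_manifold N"
  using Mg Ng by (auto simp: riemannian_manifold_def)

lemma smooth_on_local_function: "c \<in> atlas M \<Longrightarrow> smooth_on (chart_img c) (f \<circ> chart_inv c)"
  using f by (simp add: smooth_function_def)

text \<open>Lets a warped product serve as the base of a further one.\<close>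

lemma riemannian_manifold_warped: "riemannian_manifold (prod_manifold M N) (warped_metric g f g')"
  unfolding riemannian_manifold_iff
proof (intro conjI allI ballI)
  show "smooth_manifold (prod_manifold M N)"
    by (rule smooth_manifold_prod[OF smooth_factors])
  show "inner_form (warped_metric g f g' z)" for z
  proof -
    obtain p q where z: "z = (p, q)" by (cases z)
    have "inner_form (g p)" "inner_form (g' q)"
      using Mg Ng by (auto simp: riemannian_manifold_iff)
    then show ?thesis
      unfolding z
      by (rule warped_inner_form[where c = "(f p)\<^sup>2"])
        (use f_pos[of p] in \<open>auto simp: warped_metric_def\<close>)
  qed
  fix k v w assume "k \<in> atlas (prod_manifold M N)"
  then obtain c d where k: "k = prod_chart c d" and cd: "c \<in> atlas M" "d \<in> atlas N"
    by (auto simp: atlas_prod)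
  have "metric_on (chart_img c \<times> chart_img d) (local_metric (prod_manifold M N) (warped_metric g f g') k)"
    unfolding k
    by (rule warped_metric_on[OF metric_on_local_metric[OF Mg cd(1)] metric_on_local_metric[OF Ng cd(2)]
          smooth_on_local_function[OF cd(1)] _ local_metric_warped[OF smooth_factors cd]])
      (simp add: f_pos)
  then show "smooth_on (chart_img k) (\<lambda>x. local_metric (prod_manifold M N) (warped_metric g f g') k x v w)"
    by (simp add: metric_on_smooth k)
qed

text \<open>The preferred chart at \<open>(p, q)\<close> is a product chart, so the coordinate
  formulas apply there. It remains to identify their gradient, Hessian and trace with the ones on
  \<open>M\<close>.\<close>

lemma
  shows ricci_warped_base: "ricci (prod_manifold M N) (warped_metric g f g') (p, q) (v, 0) (w, 0) =
      ricci M g p v w - real DIM('f) / f p * hessian M g f p v w" (is ?base)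
    and ricci_warped_fiber: "ricci (prod_manifold M N) (warped_metric g f g') (p, q) (0, v') (0, w') =
      ricci N g' q v' w' - (f p * laplacian M g f p
        + (real DIM('f) - 1) * (metric_norm g p (grad M g f p))\<^sup>2) * g' q v' w'" (is ?fiber)
proof -
  note M = smooth_factors(1) and N = smooth_factors(2)
  let ?c = "chart_at M p" and ?d = "chart_at N q"
  let ?x = "chart_map ?c p" and ?y = "chart_map ?d q"
  note cd = chart_at_in_atlas[OF M, of p] chart_at_in_atlas[OF N, of q]
  have xy: "?x \<in> chart_img ?c" "?y \<in> chart_img ?d"
    using in_chart_at_dom[OF M] in_chart_at_dom[OF N] by (auto simp: chart_img_def)
  have p: "chart_inv ?c ?x = p"
    by (rule chart_inv_map[OF M cd(1) in_chart_at_dom[OF M]])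
  note gM = metric_on_local_metric[OF Mg cd(1)]
  note fM = smooth_on_local_function[OF cd(1)]
  note W = gM metric_on_local_metric[OF Ng cd(2)] fM _ local_metric_warped[OF M N cd]
  have hess: "hessian M g f p = local_hessian (local_metric M g ?c) (f \<circ> chart_inv ?c) ?x"
    by (simp add: hessian_def local_hessian_def Let_def fun_eq_iff)
  have gp: "local_metric M g ?c ?x = g p" "local_metric N g' ?d ?y = g' q"
    by (rule local_metric_chart_at[OF M], rule local_metric_chart_at[OF N])
  have gr: "grad M g f p = local_grad (local_metric M g ?c) (f \<circ> chart_inv ?c) ?x"
    by (simp add: grad_def local_grad_def differential_def[abs_def] Let_def gp)
  \<comment> \<open>The norm is a square root, and squaring undoes it because the metric is
    nonnegative on the diagonal.\<close>
  have "(metric_norm g p (grad M g f p))\<^sup>2 = g p (grad M g f p) (grad M g f p)"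
    unfolding metric_norm_def
    using Mg inner_form_nonneg by (auto simp: riemannian_manifold_iff)
  also have "\<dots> = ddir (f \<circ> chart_inv ?c) ?x (local_grad (local_metric M g ?c) (f \<circ> chart_inv ?c) ?x)"
    using metric_local_grad[OF gM fM xy(1)] by (simp add: gr gp)
  finally have nrm: "(metric_norm g p (grad M g f p))\<^sup>2 =
      ddir (f \<circ> chart_inv ?c) ?x (local_grad (local_metric M g ?c) (f \<circ> chart_inv ?c) ?x)" .
  define fc where "fc = f \<circ> chart_inv ?c"
  have fp: "fc ?x = f p" and f0: "\<And>x. fc x > 0"
    by (simp_all add: fc_def p f_pos)
  show ?base
    using local_ricci_warped_base[OF W xy, folded fc_def, OF f0, of v w]
    by (simp add: ricci_def Let_def hess[folded fc_def] fp)
  show ?fiber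
    using local_ricci_warped_fiber[OF W xy, folded fc_def, OF f0, of v' w']
    by (simp add: ricci_def Let_def laplacian_def hess[folded fc_def] nrm[folded fc_def] gp fp)
qed

end

section \<open>Ricci tensors of the factors of a quasi-Einstein sequential warped product\<close>

theorem proposition2p1:
  fixes M1 :: "('a1::{t2_space,second_countable_topology}, 'e1::euclidean_space) manifold"
    and M2 :: "('a2::{t2_space,second_countable_topology}, 'e2::euclidean_space) manifold"
    and M3 :: "('a3::{t2_space,second_countable_topology}, 'e3::euclidean_space) manifold"
    and g1 :: "('a1, 'e1) metric"
    and g2 :: "('a2, 'e2) metric"
    and g3 :: "('a3, 'e3) metric"
    and f :: "'a1 \<Rightarrow> real"
    and h :: "'a1 \<times> 'a2 \<Rightarrow> real"
    and \<alpha> \<beta> :: "('a1 \<times> 'a2) \<times> 'a3 \<Rightarrow> real"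
    and A :: "('a1 \<times> 'a2) \<times> 'a3 \<Rightarrow> ('e1 \<times> 'e2) \<times> 'e3 \<Rightarrow> real"
    and U :: "('a1 \<times> 'a2) \<times> 'a3 \<Rightarrow> ('e1 \<times> 'e2) \<times> 'e3"
    and U1 :: "('a1 \<times> 'a2) \<times> 'a3 \<Rightarrow> 'e1"
    and U2 :: "('a1 \<times> 'a2) \<times> 'a3 \<Rightarrow> 'e2"
    and U3 :: "('a1 \<times> 'a2) \<times> 'a3 \<Rightarrow> 'e3"
  defines "M12 \<equiv> prod_manifold M1 M2" and "g12 \<equiv> warped_metric g1 f g2"
  assumes "riemannian_manifold M1 g1" "riemannian_manifold M2 g2" "riemannian_manifold M3 g3"
    and "smooth_function M1 f" "\<And>a. f a > 0"
    and "smooth_function M12 h" "\<And>p. h p > 0"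
    and "quasi_einstein (prod_manifold M12 M3) (warped_metric g12 h g3) \<alpha> \<beta> A U"
    and "\<And>p. U p = ((U1 p, U2 p), U3 p)"
  shows
    "(\<forall>X1 Y1. vector_field M1 X1 \<longrightarrow> vector_field M1 Y1 \<longrightarrow>
       (\<forall>a b c. let p = ((a, b), c) in
         ricci M1 g1 a (X1 a) (Y1 a) =
           \<alpha> p * g1 a (X1 a) (Y1 a)
           + \<beta> p * g1 a (X1 a) (U1 p) * g1 a (Y1 a) (U1 p)
           + real DIM('e2) / f a * hessian M1 g1 f a (X1 a) (Y1 a)
           + real DIM('e3) / h (a, b) * hessian M12 g12 h (a, b) (X1 a, 0) (Y1 a, 0))) \<and>
     (\<forall>X2 Y2. vector_field M2 X2 \<longrightarrow> vector_field M2 Y2 \<longrightarrow>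
       (\<forall>a b c. let p = ((a, b), c) in
         ricci M2 g2 b (X2 b) (Y2 b) =
           (\<alpha> p * (f a)\<^sup>2 + f a * laplacian M1 g1 f a
             + (real DIM('e2) - 1) * (metric_norm g1 a (grad M1 g1 f a))\<^sup>2) * g2 b (X2 b) (Y2 b)
           + \<beta> p * (f a) ^ 4 * g2 b (X2 b) (U2 p) * g2 b (Y2 b) (U2 p)
           + real DIM('e3) / h (a, b) * hessian M12 g12 h (a, b) (0, X2 b) (0, Y2 b))) \<and>
     (\<forall>X3 Y3. vector_field M3 X3 \<longrightarrow> vector_field M3 Y3 \<longrightarrow>
       (\<forall>a b c. let p = ((a, b), c) in
         ricci M3 g3 c (X3 c) (Y3 c) =
           (\<alpha> p * (h (a, b))\<^sup>2 + h (a, b) * laplacian M12 g12 h (a, b)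
             + (real DIM('e3) - 1) * (metric_norm g12 (a, b) (grad M12 g12 h (a, b)))\<^sup>2)
             * g3 c (X3 c) (Y3 c)
           + \<beta> p * (h (a, b)) ^ 4 * g3 c (X3 c) (U3 p) * g3 c (Y3 c) (U3 p)))"
proof -
  note R1 = assms(3) and R2 = assms(4) and R3 = assms(5) and f = assms(6,7) and h = assms(8,9)
    and QE = assms(10) and U = assms(11)
  have R12: "riemannian_manifold M12 g12"
    unfolding M12_def g12_def by (rule riemannian_manifold_warped[OF R1 R2 f])
  note S1 = R1[unfolded riemannian_manifold_iff, THEN conjunct1]
    and S2 = R2[unfolded riemannian_manifold_iff, THEN conjunct1]
    and S3 = R3[unfolded riemannian_manifold_iff, THEN conjunct1]
    and S12 = R12[unfolded riemannian_manifold_iff, THEN conjunct1]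
  note lift12 = vector_field_lift_fst[OF S1 S2, folded M12_def] vector_field_lift_snd[OF S1 S2, folded M12_def]
  have zero [simp]: "g1 a 0 v = 0" "g1 a v 0 = 0" "g2 b 0 w = 0" "g2 b w 0 = 0" "g3 c 0 z = 0" "g3 c z 0 = 0"
    for a b c v w z
    using R1 R2 R3 by (auto simp: riemannian_manifold_def bilinear_lzero bilinear_rzero)
  have QE_ricci: "ricci (prod_manifold M12 M3) (warped_metric g12 h g3) p (X p) (Y p) =
      \<alpha> p * warped_metric g12 h g3 p (X p) (Y p)
      + \<beta> p * warped_metric g12 h g3 p (X p) (U p) * warped_metric g12 h g3 p (Y p) (U p)"
    if "vector_field (prod_manifold M12 M3) X" "vector_field (prod_manifold M12 M3) Y" for X Y p
    using QE that unfolding quasi_einstein_def by (simp del: split_paired_All)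
  have g12: "g12 (a, b) (v, v') (w, w') = g1 a v w + (f a)\<^sup>2 * g2 b v' w'"
    and gbar: "warped_metric g12 h g3 ((a, b), c) (u, z) (u', z') =
      g12 (a, b) u u' + (h (a, b))\<^sup>2 * g3 c z z'" for a b c v v' w w' u u' z z'
    by (simp_all add: g12_def warped_metric_def)
  have g12_zero: "g12 q 0 u = 0" for q u
    using R12 bilinear_lzero unfolding riemannian_manifold_def by blast
  note base12 = ricci_warped_base[OF R1 R2 f, folded M12_def g12_def]
    and fiber12 = ricci_warped_fiber[OF R1 R2 f, folded M12_def g12_def]
    and base = ricci_warped_base[OF R12 R3 h] and fiber = ricci_warped_fiber[OF R12 R3 h]
  show ?thesis
  proof (intro conjI allI impI)
    fix X Y a b c assume X: "vector_field M1 X" and Y: "vector_field M1 Y"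
    show "let p = ((a, b), c) in ricci M1 g1 a (X a) (Y a) =
        \<alpha> p * g1 a (X a) (Y a) + \<beta> p * g1 a (X a) (U1 p) * g1 a (Y a) (U1 p)
        + real DIM('e2) / f a * hessian M1 g1 f a (X a) (Y a)
        + real DIM('e3) / h (a, b) * hessian M12 g12 h (a, b) (X a, 0) (Y a, 0)"
      \<comment> \<open>The field is lifted twice and is tangent to the base both times, so each of
        the two warpings contributes a Hessian term.\<close>
      using QE_ricci[OF vector_field_lift_fst[OF S12 S3 lift12(1)[OF X]]
          vector_field_lift_fst[OF S12 S3 lift12(1)[OF Y]], of "((a, b), c)"]
      by (simp add: base base12 U g12 gbar)
  next
    fix X Y a b c assume X: "vector_field M2 X" and Y: "vector_field M2 Y"
    show "let p = ((a, b), c) in ricci M2 g2 b (X b) (Y b) =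
        (\<alpha> p * (f a)\<^sup>2 + f a * laplacian M1 g1 f a
          + (real DIM('e2) - 1) * (metric_norm g1 a (grad M1 g1 f a))\<^sup>2) * g2 b (X b) (Y b)
        + \<beta> p * (f a) ^ 4 * g2 b (X b) (U2 p) * g2 b (Y b) (U2 p)
        + real DIM('e3) / h (a, b) * hessian M12 g12 h (a, b) (0, X b) (0, Y b)"
      \<comment> \<open>Here the field is tangent to the base of the outer product and to the fibre
        of the inner one. Each of the two pairings with \<open>U\<close> carries a factor
        \<open>(f a)\<^sup>2\<close>, hence the fourth power.\<close>
      using QE_ricci[OF vector_field_lift_fst[OF S12 S3 lift12(2)[OF X]]
          vector_field_lift_fst[OF S12 S3 lift12(2)[OF Y]], of "((a, b), c)"]
      by (simp add: base fiber12 U g12 gbar)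
         (simp add: algebra_simps power2_eq_square power4_eq_xxxx)
  next
    fix X Y a b c assume X: "vector_field M3 X" and Y: "vector_field M3 Y"
    show "let p = ((a, b), c) in ricci M3 g3 c (X c) (Y c) =
        (\<alpha> p * (h (a, b))\<^sup>2 + h (a, b) * laplacian M12 g12 h (a, b)
          + (real DIM('e3) - 1) * (metric_norm g12 (a, b) (grad M12 g12 h (a, b)))\<^sup>2) * g3 c (X c) (Y c)
        + \<beta> p * (h (a, b)) ^ 4 * g3 c (X c) (U3 p) * g3 c (Y c) (U3 p)"
      \<comment> \<open>Only the outer warping is involved: the base component of the lift is zero,
        and each pairing with \<open>U\<close> carries a factor
        \<open>(h (a, b))\<^sup>2\<close>.\<close>
      using QE_ricci[OF vector_field_lift_snd[OF S12 S3 X] vector_field_lift_snd[OF S12 S3 Y],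
          of "((a, b), c)"]
      by (simp add: fiber U gbar g12_zero) (simp add: algebra_simps power2_eq_square power4_eq_xxxx)
  qed
qed

end
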